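(* Let $\mathcal G$ be a non-empty ample groupoid (not necessarily Hausdorff) and let $K$ be a field. Then the essential algebra of $\mathcal G$ over $K$ is simple if and only if $\mathcal G$ is minimal and topologically free.
   Context: A groupoid $\mathcal G$ is identified with its set of arrows; $\mathcal G^0\subseteq\mathcal G$ is the set of identities (unit space), $d,r:\mathcal G\to\mathcal G^0$ are the domain and range maps, and $\alpha\beta$ is defined when $d(\alpha)=r(\beta)$. A topological groupoid (domain, range, multiplication and inversion continuous, $\mathcal G^0$ with the subspace topology) is étale if $d$ is a local homeomorphism; $\mathcal G^0$ is always assumed locally compact Hausdorff, but $\mathcal G$ need not be Hausdorff. It is ample if moreover $\mathcal G^0$ has a basis of compact open sets. A local bisection is an open set $U\subseteq\mathcal G$ such that $d|_U$ and $r|_U$ are homeomorphisms onto their images. Steinberg algebra: for a commutative unital ring $K$, $K\mathcal G$ is the $K$-span in $K^{\mathcal G}$ of the characteristic functions $\chi_U$ of compact local bisections $U$, with convolution $(f*g)(\gamma)=\sum_{\alpha\beta=\gamma}f(\alpha)g(\beta)$. A function $f\in K\mathcal G$ is singular if $\operatorname{supp}(f)=f^{-1}(K\setminus\{0\})$ (no closure taken) has empty interior in $\mathcal G$. The singular functions form a two-sided ideal $I_K(\mathcal G)$ of $K\mathcal G$, and the essential algebra of $\mathcal G$ over $K$ is the quotient $K\mathcal G/I_K(\mathcal G)$. The orbit of $x\in\mathcal G^0$ is $\{r(g): g\in\mathcal G,\ d(g)=x\}$. $\mathcal G$ is minimal if every orbit is dense in $\mathcal G^0$. With $\mathrm{Iso}(\mathcal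 G)=\{g: d(g)=r(g)\}$, $\mathcal G$ is topologically free if $\mathrm{Iso}(\mathcal G)\setminus\mathcal G^0$ has empty interior in $\mathcal G$. An algebra is simple if it is non-zero and has no two-sided ideals other than $0$ and itself. *)

theory Defs
  imports "HOL-Analysis.Analysis" "HOL-Library.Function_Algebras"
begin

section \<open>Topological, etale and ample groupoids\<close>

text \<open>The set of arrows is the underlying set of the topology. The values of the structure maps
  outside the set of arrows (for \<open>gmul\<close>: outside the composable pairs) are irrelevant.\<close>

record 'g tgroupoid =
  gtop :: "'g topology"
  gdom :: "'g \<Rightarrow> 'g"
  grng :: "'g \<Rightarrow> 'g"
  gmul :: "'g \<Rightarrow> 'g \<Rightarrow> 'g"
  ginv :: "'g \<Rightarrow> 'g"

definition arrows :: "'g tgroupoid \<Rightarrow> 'g set"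
  where "arrows G = topspace (gtop G)"

definition units :: "'g tgroupoid \<Rightarrow> 'g set"
  where "units G = gdom G ` arrows G"

definition composable :: "'g tgroupoid \<Rightarrow> ('g \<times> 'g) set"
  where "composable G = {(a, b). a \<in> arrows G \<and> b \<in> arrows G \<and> gdom G a = grng G b}"

definition unit_top :: "'g tgroupoid \<Rightarrow> 'g topology"
  where "unit_top G = subtopology (gtop G) (units G)"

locale groupoid =
  fixes G :: "'g tgroupoid"
  assumes dom_arrow: "a \<in> arrows G \<Longrightarrow> gdom G a \<in> arrows G"
    and rng_unit: "a \<in> arrows G \<Longrightarrow> grng G a \<in> units G"
    and dom_of_unit: "x \<in> units G \<Longrightarrow> gdom G x = x"
    and rng_of_unit: "x \<in> units G \<Longrightarrow> grng G x = x"
    and mul_arrow: "(a, b) \<in> composable G \<Longrightarrow> gmul G a b \<in> arrows G"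
    and dom_mul: "(a, b) \<in> composable G \<Longrightarrow> gdom G (gmul G a b) = gdom G b"
    and rng_mul: "(a, b) \<in> composable G \<Longrightarrow> grng G (gmul G a b) = grng G a"
    and mul_assoc: "(a, b) \<in> composable G \<Longrightarrow> (b, c) \<in> composable G \<Longrightarrow>
        gmul G (gmul G a b) c = gmul G a (gmul G b c)"
    and mul_dom: "a \<in> arrows G \<Longrightarrow> gmul G a (gdom G a) = a"
    and rng_mul_left: "a \<in> arrows G \<Longrightarrow> gmul G (grng G a) a = a"
    and inv_arrow: "a \<in> arrows G \<Longrightarrow> ginv G a \<in> arrows G"
    and dom_inv: "a \<in> arrows G \<Longrightarrow> gdom G (ginv G a) = grng G a"
    and rng_inv: "a \<in> arrows G \<Longrightarrow> grng G (ginv G a) = gdom G a"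
    and inv_mul: "a \<in> arrows G \<Longrightarrow> gmul G (ginv G a) a = gdom G a"
    and mul_inv: "a \<in> arrows G \<Longrightarrow> gmul G a (ginv G a) = grng G a"

locale topological_groupoid = groupoid +
  assumes continuous_dom: "continuous_map (gtop G) (unit_top G) (gdom G)"
    and continuous_rng: "continuous_map (gtop G) (unit_top G) (grng G)"
    and continuous_mul: "continuous_map
        (subtopology (prod_topology (gtop G) (gtop G)) (composable G)) (gtop G)
        (\<lambda>(a, b). gmul G a b)"
    and continuous_inv: "continuous_map (gtop G) (gtop G) (ginv G)"

definition local_homeomorphism_map :: "'a topology \<Rightarrow> 'b topology \<Rightarrow> ('a \<Rightarrow> 'b) \<Rightarrow> bool"
  where "local_homeomorphism_map X Y f \<longleftrightarrow>
    (\<forall>x \<in> topspace X. \<exists>U. openin X U \<and> x \<in> U \<and> openin Y (f ` U) \<and>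
       homeomorphic_map (subtopology X U) (subtopology Y (f ` U)) f)"

locale etale_groupoid = topological_groupoid +
  assumes dom_local_homeomorphism: "local_homeomorphism_map (gtop G) (unit_top G) (gdom G)"
    and units_locally_compact: "locally_compact_space (unit_top G)"
    and units_Hausdorff: "Hausdorff_space (unit_top G)"

locale ample_groupoid = etale_groupoid +
  assumes units_compact_open_basis:
    "\<exists>\<B>. (\<forall>B \<in> \<B>. openin (unit_top G) B \<and> compactin (unit_top G) B) \<and>
         (\<forall>W. openin (unit_top G) W \<longrightarrow> (\<exists>\<B>'. \<B>' \<subseteq> \<B> \<and> \<Union>\<B>' = W))"

definition local_bisection :: "'g tgroupoid \<Rightarrow> 'g set \<Rightarrow> bool"
  where "local_bisection G U \<longleftrightarrow> openin (gtop G) U \<and>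
    homeomorphic_map (subtopology (gtop G) U) (subtopology (unit_top G) (gdom G ` U)) (gdom G) \<and>
    homeomorphic_map (subtopology (gtop G) U) (subtopology (unit_top G) (grng G ` U)) (grng G)"

definition orbit :: "'g tgroupoid \<Rightarrow> 'g \<Rightarrow> 'g set"
  where "orbit G x = {grng G g | g. g \<in> arrows G \<and> gdom G g = x}"

definition minimal_groupoid :: "'g tgroupoid \<Rightarrow> bool"
  where "minimal_groupoid G \<longleftrightarrow>
    (\<forall>x \<in> units G. unit_top G closure_of orbit G x = topspace (unit_top G))"

definition isotropy :: "'g tgroupoid \<Rightarrow> 'g set"
  where "isotropy G = {g \<in> arrows G. gdom G g = grng G g}"

definition topologically_free :: "'g tgroupoid \<Rightarrow> bool"
  where "topologically_free G \<longleftrightarrow> gtop G interior_of (isotropy G - units G) = {}"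

section \<open>Algebras without unit, ideals, quotients, simplicity\<close>

record ('k, 'a) nu_algebra =
  alg_carrier :: "'a set"
  alg_zero :: "'a"
  alg_add :: "'a \<Rightarrow> 'a \<Rightarrow> 'a"
  alg_smult :: "'k \<Rightarrow> 'a \<Rightarrow> 'a"
  alg_mult :: "'a \<Rightarrow> 'a \<Rightarrow> 'a"

definition two_sided_ideal :: "('k, 'a) nu_algebra \<Rightarrow> 'a set \<Rightarrow> bool"
  where "two_sided_ideal A J \<longleftrightarrow>
    J \<subseteq> alg_carrier A \<and> alg_zero A \<in> J \<and>
    (\<forall>x \<in> J. \<forall>y \<in> J. alg_add A x y \<in> J) \<and>
    (\<forall>c. \<forall>x \<in> J. alg_smult A c x \<in> J) \<and>
    (\<forall>a \<in> alg_carrier A. \<forall>x \<in> J. alg_mult A a x \<in> J \<and> alg_mult A x a \<in> J)"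

definition simple_algebra :: "('k, 'a) nu_algebra \<Rightarrow> bool"
  where "simple_algebra A \<longleftrightarrow> alg_carrier A \<noteq> {alg_zero A} \<and>
    (\<forall>J. two_sided_ideal A J \<longrightarrow> J = {alg_zero A} \<or> J = alg_carrier A)"

definition alg_coset :: "('k, 'a) nu_algebra \<Rightarrow> 'a set \<Rightarrow> 'a \<Rightarrow> 'a set"
  where "alg_coset A J a = alg_add A a ` J"

text \<open>When \<open>J\<close> is a two-sided ideal of \<open>A\<close>, all cosets in each of the unions below coincide,
  so the operations are the usual ones on representatives.\<close>

definition quotient_algebra :: "('k, 'a) nu_algebra \<Rightarrow> 'a set \<Rightarrow> ('k, 'a set) nu_algebra"
  where "quotient_algebra A J = \<lparr>
    alg_carrier = alg_coset A J ` alg_carrier A,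
    alg_zero = alg_coset A J (alg_zero A),
    alg_add = (\<lambda>X Y. \<Union>x \<in> X. \<Union>y \<in> Y. alg_coset A J (alg_add A x y)),
    alg_smult = (\<lambda>c X. \<Union>x \<in> X. alg_coset A J (alg_smult A c x)),
    alg_mult = (\<lambda>X Y. \<Union>x \<in> X. \<Union>y \<in> Y. alg_coset A J (alg_mult A x y)) \<rparr>"

section \<open>The Steinberg algebra and the essential algebra\<close>

text \<open>A \<open>K\<close>-valued function on the groupoid is represented by its extension by zero to the whole
  type \<open>'g\<close>; addition and zero of functions are pointwise.\<close>

definition fun_scale :: "'k::comm_ring_1 \<Rightarrow> ('g \<Rightarrow> 'k) \<Rightarrow> 'g \<Rightarrow> 'k"
  where "fun_scale c f = (\<lambda>g. c * f g)"

interpretation fun_module: module "fun_scale :: 'k::comm_ring_1 \<Rightarrow> ('g \<Rightarrow> 'k) \<Rightarrow> 'g \<Rightarrow> 'k"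
  by unfold_locales (auto simp: fun_scale_def algebra_simps fun_eq_iff)

definition steinberg_functions :: "'g tgroupoid \<Rightarrow> ('g \<Rightarrow> 'k::comm_ring_1) set"
  where "steinberg_functions G =
    module.span fun_scale {indicator U | U. local_bisection G U \<and> compactin (gtop G) U}"

text \<open>There may be infinitely many factorizations \<open>\<alpha>\<beta> = \<gamma>\<close>, and the library's sum over an infinite
  set is \<open>0\<close>; so the sum is restricted to the nonzero summands, of which there are only finitely
  many when \<open>f\<close> and \<open>g\<close> are in the Steinberg algebra.\<close>

definition convolution ::
    "'g tgroupoid \<Rightarrow> ('g \<Rightarrow> 'k::comm_ring_1) \<Rightarrow> ('g \<Rightarrow> 'k) \<Rightarrow> 'g \<Rightarrow> 'k"
  where "convolution G f g = (\<lambda>\<gamma>.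
    \<Sum>(\<alpha>, \<beta>) \<in> {(\<alpha>, \<beta>) \<in> composable G. gmul G \<alpha> \<beta> = \<gamma> \<and> f \<alpha> * g \<beta> \<noteq> 0}. f \<alpha> * g \<beta>)"

definition steinberg_algebra :: "'g tgroupoid \<Rightarrow> ('k::comm_ring_1, 'g \<Rightarrow> 'k) nu_algebra"
  where "steinberg_algebra G = \<lparr>
    alg_carrier = steinberg_functions G,
    alg_zero = 0,
    alg_add = (+),
    alg_smult = fun_scale,
    alg_mult = convolution G \<rparr>"

definition singular_functions :: "'g tgroupoid \<Rightarrow> ('g \<Rightarrow> 'k::comm_ring_1) set"
  where "singular_functions G =
    {f \<in> steinberg_functions G. gtop G interior_of {g \<in> arrows G. f g \<noteq> 0} = {}}"

definition essential_algebra :: "'g tgroupoid \<Rightarrow> ('k::comm_ring_1, ('g \<Rightarrow> 'k) set) nu_algebra"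
  where "essential_algebra G = quotient_algebra (steinberg_algebra G) (singular_functions G)"

end

theory Submission
  imports Defs
begin

text \<open>Every function in the Steinberg algebra is constant on some nonempty open subset of any given
  nonempty open set, so the support of a singular function is nowhere dense.

  Let the Steinberg algebra act on the free module over an invariant set \<open>S\<close> of units: the matrix
  coefficient of \<open>f\<close> at \<open>(y, z)\<close> is the sum of \<open>f\<close> over the arrows from \<open>z\<close> to \<open>y\<close>. The sum of \<open>f\<close> over
  all arrows starting at \<open>z\<close> is locally constant in \<open>z\<close>, hence zero if \<open>f\<close> is singular, and this
  implies that singular functions act by zero. If the essential algebra is simple, the kernel of
  the action therefore consists of singular functions only. For \<open>S\<close> an orbit that misses a compact
  open set \<open>V\<close> of units, the indicator of \<open>V\<close> is a nonsingular element of the kernel; for \<open>S\<close> the unit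
  space and \<open>U\<close> a bisection inside the isotropy minus the units, the difference of the indicators of
  \<open>U\<close> and \<open>d(U)\<close> is.

  Conversely, translating a nonsingular element of an ideal by a bisection makes it nonzero on an open
  set of units. Given finitely many compact bisections whose indicators span it, topological freeness
  provides a small compact open set \<open>V\<close> of units such that each of the bisections contains \<open>V\<close> or has
  no arrow from \<open>V\<close> to \<open>V\<close>. Cutting down to \<open>V\<close> on both sides leaves a nonzero multiple of the
  indicator of \<open>V\<close>, and by minimality this generates the whole algebra.\<close>

section \<open>Groupoid identities\<close>

context groupoid
begin

abbreviation d where "d \<equiv> gdom G"
abbreviation r where "r \<equiv> grng G"
abbreviation iv where "iv \<equiv> ginv G"
abbreviation mul (infixl "\<cdot>" 70) where "a \<cdot> b \<equiv> gmul G a b"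
abbreviation X where "X \<equiv> gtop G"

lemma composable_iff [simp]:
  "(a, b) \<in> composable G \<longleftrightarrow> a \<in> arrows G \<and> b \<in> arrows G \<and> d a = r b"
  by (simp add: composable_def)

lemma dom_in_units [simp]: "a \<in> arrows G \<Longrightarrow> d a \<in> units G"
  by (simp add: units_def)

lemma units_subset_arrows: "units G \<subseteq> arrows G"
  using dom_arrow by (auto simp: units_def)

lemma unit_arrow [simp]: "x \<in> units G \<Longrightarrow> x \<in> arrows G"
  using units_subset_arrows by blast

lemmas groupoid_simps [simp] =
  rng_unit dom_of_unit rng_of_unit dom_inv rng_inv inv_arrow mul_dom rng_mul_left inv_mul mul_inv

lemma mul_simps [simp]:
  assumes "a \<in> arrows G" "b \<in> arrows G" "d a = r b"
  shows "a \<cdot> b \<in> arrows G" "d (a \<cdot> b) = d b" "r (a \<cdot> b) = r a"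
  using mul_arrow[of a b] dom_mul[of a b] rng_mul[of a b] assms by simp_all

lemma inv_mul_cancel [simp]:
  assumes "a \<in> arrows G" "b \<in> arrows G" "d a = r b"
  shows "iv a \<cdot> (a \<cdot> b) = b"
  using mul_assoc[of "iv a" a b] assms by simp

lemma inv_inv [simp]:
  assumes "a \<in> arrows G" shows "iv (iv a) = a"
  using inv_mul_cancel[of "iv a" a] mul_dom[of "iv (iv a)"] assms by simp

lemma mul_inv_cancel [simp]:
  assumes "a \<in> arrows G" "b \<in> arrows G" "r a = r b"
  shows "a \<cdot> (iv a \<cdot> b) = b"
  using inv_mul_cancel[of "iv a" b] assms by simp

lemma inv_eqI:
  assumes "a \<in> arrows G" "b \<in> arrows G" "d a = r b" "a \<cdot> b = r a"
  shows "b = iv a"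
  using inv_mul_cancel[of a b] mul_dom[of "iv a"] assms by simp

lemma inv_unit [simp]: "x \<in> units G \<Longrightarrow> iv x = x"
  using inv_eqI[of x x] mul_dom[of x] by simp

lemma inv_mul_distrib:
  assumes "a \<in> arrows G" "b \<in> arrows G" "d a = r b"
  shows "iv (a \<cdot> b) = iv b \<cdot> iv a"
proof -
  have "(a \<cdot> b) \<cdot> (iv b \<cdot> iv a) = a \<cdot> (b \<cdot> (iv b \<cdot> iv a))"
    using assms by (intro mul_assoc) auto
  also have "\<dots> = r a" using assms by simp
  finally show ?thesis using assms inv_eqI[of "a \<cdot> b" "iv b \<cdot> iv a"] by simp
qed

lemma mul_right_unit [simp]: "\<lbrakk>a \<in> arrows G; x \<in> units G; d a = x\<rbrakk> \<Longrightarrow> a \<cdot> x = a"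
  using mul_dom by blast

lemma mul_left_unit [simp]: "\<lbrakk>a \<in> arrows G; x \<in> units G; r a = x\<rbrakk> \<Longrightarrow> x \<cdot> a = a"
  using rng_mul_left by blast

lemma mem_inv_image [simp]:
  assumes "W \<subseteq> arrows G"
  shows "g \<in> iv ` W \<longleftrightarrow> g \<in> arrows G \<and> iv g \<in> W"
proof
  assume "g \<in> arrows G \<and> iv g \<in> W"
  then show "g \<in> iv ` W" using inv_inv[of g] by (metis imageI)
qed (use assms in auto)

lemma inv_image_inv_image: "W \<subseteq> arrows G \<Longrightarrow> iv ` iv ` W = W"
  by (auto simp: image_image subset_iff image_iff)

lemma dom_inv_image [simp]: "W \<subseteq> arrows G \<Longrightarrow> d ` iv ` W = r ` W"
  by (auto simp: image_image subset_iff image_iff)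

lemma rng_inv_image [simp]: "W \<subseteq> arrows G \<Longrightarrow> r ` iv ` W = d ` W"
  by (auto simp: image_image subset_iff image_iff)

lemma mem_orbit_self [simp]: "x \<in> units G \<Longrightarrow> x \<in> orbit G x"
  unfolding orbit_def by (auto intro!: exI[of _ x])

text \<open>Composing with an arrow that starts at \<open>x\<close> carries membership from
  \<open>d g\<close> to \<open>r g\<close>; the same argument for \<open>iv g\<close> gives the
  converse.\<close>

lemma orbit_invariant:
  assumes "g \<in> arrows G"
  shows "d g \<in> orbit G x \<longleftrightarrow> r g \<in> orbit G x"
proof -
  have *: "r g \<in> orbit G x" if g: "g \<in> arrows G" "d g \<in> orbit G x" for g
  proof -
    obtain h where h: "h \<in> arrows G" "d h = x" "r h = d g" using g by (auto simp: orbit_def)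
    then show ?thesis using g unfolding orbit_def by (auto intro!: exI[of _ "g \<cdot> h"])
  qed
  from *[of g] *[of "iv g"] assms show ?thesis by auto
qed

end

section \<open>Continuity of the structure maps\<close>

context topological_groupoid
begin

lemma topspace_X [simp]: "topspace X = arrows G"
  by (simp add: arrows_def)

lemma topspace_unit_top [simp]: "topspace (unit_top G) = units G"
  using units_subset_arrows by (auto simp: unit_top_def)

lemma openin_arrows: "openin X W \<Longrightarrow> W \<subseteq> arrows G"
  using openin_subset by force

lemma continuous_map_dom: "continuous_map X X d"
  using continuous_dom by (simp add: unit_top_def continuous_map_in_subtopology)

lemma continuous_map_rng: "continuous_map X X r"
  using continuous_rng by (simp add: unit_top_def continuous_map_in_subtopology)

lemma openin_dom_vimage: "openin X N \<Longrightarrow> openin X {g \<in> arrows G. d g \<in> N}"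
  using continuous_map_dom by (auto simp: continuous_map)

lemma openin_rng_vimage: "openin X N \<Longrightarrow> openin X {g \<in> arrows G. r g \<in> N}"
  using continuous_map_rng by (auto simp: continuous_map)

lemma openin_inv_image:
  assumes "openin X W" shows "openin X (iv ` W)"
proof -
  have "iv ` W = {g \<in> arrows G. iv g \<in> W}" using openin_arrows[OF assms] by auto
  then show ?thesis using continuous_inv assms by (auto simp: continuous_map)
qed

end

section \<open>Topology of ample groupoids\<close>

context etale_groupoid
begin

lemma dom_homeomorphic_nbhd:
  assumes "g \<in> arrows G"
  obtains U where "openin X U" "g \<in> U" "openin (unit_top G) (d ` U)" "inj_on d U"
    "homeomorphic_map (subtopology X U) (subtopology (unit_top G) (d ` U)) d"
proof -
  have "\<exists>U. openin X U \<and> g \<in> U \<and> openin (unit_top G) (d ` U) \<and>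
      homeomorphic_map (subtopology X U) (subtopology (unit_top G) (d ` U)) d"
    using dom_local_homeomorphism assms unfolding local_homeomorphism_map_def topspace_X by (rule bspec)
  then obtain U where U: "openin X U" "g \<in> U" "openin (unit_top G) (d ` U)"
    "homeomorphic_map (subtopology X U) (subtopology (unit_top G) (d ` U)) d" by blast
  moreover have "inj_on d U"
    using openin_arrows[OF U(1)] homeomorphic_imp_injective_map[OF U(4)]
    by (simp add: Int_absorb1)
  ultimately show thesis using that by blast
qed

text \<open>Near a unit, \<open>d\<close> is injective on an open set \<open>U\<close>. An arrow
  \<open>g\<close> of \<open>U\<close> whose domain also lies in \<open>U\<close> has the same
  domain as \<open>d g\<close>, hence equals it and is a unit.\<close>

lemma open_units: "openin X (units G)"
proof (subst openin_subopen, intro ballI)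
  fix x assume x: "x \<in> units G"
  obtain U where U: "openin X U" "x \<in> U" and inj: "inj_on d U"
    using dom_homeomorphic_nbhd x unit_arrow by blast
  define T where "T = {g \<in> arrows G. d g \<in> U} \<inter> U"
  have "openin X T" "x \<in> T"
    using U x by (auto simp: T_def intro!: openin_dom_vimage)
  moreover have "T \<subseteq> units G"
  proof
    fix g assume "g \<in> T"
    then have "g \<in> arrows G" "g \<in> U" "d g \<in> U" "d (d g) = d g" by (auto simp: T_def)
    then have "g = d g" using inj_onD[OF inj, of "d g" g] by simp
    then show "g \<in> units G" using \<open>g \<in> arrows G\<close> by (metis dom_in_units)
  qed
  ultimately show "\<exists>T. openin X T \<and> x \<in> T \<and> T \<subseteq> units G" by blast
qed

lemma openin_unit_top_iff: "openin (unit_top G) N \<longleftrightarrow> openin X N \<and> N \<subseteq> units G"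
  using open_units by (simp add: unit_top_def openin_open_subtopology)

lemma compactin_unit_top_iff: "compactin (unit_top G) N \<longleftrightarrow> compactin X N \<and> N \<subseteq> units G"
  by (simp add: unit_top_def compactin_subtopology)

text \<open>Openness is local: each point of d(W) comes from a chart on which \<open>d\<close> is a
  homeomorphism onto an open set of units, and open sets of units are open in the whole
  groupoid.\<close>

lemma open_dom:
  assumes W: "openin X W" shows "openin X (d ` W)"
proof (subst openin_subopen, intro ballI)
  fix x assume "x \<in> d ` W"
  then obtain g where g: "g \<in> W" "x = d g" by blast
  then obtain U where U: "openin X U" "g \<in> U" "openin (unit_top G) (d ` U)"
    "homeomorphic_map (subtopology X U) (subtopology (unit_top G) (d ` U)) d"
    using dom_homeomorphic_nbhd openin_arrows[OF W] by blast
  have "openin (subtopology X U) (W \<inter> U)" using W U by (simp add: openin_subtopology_Int)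
  then have "openin (subtopology (unit_top G) (d ` U)) (d ` (W \<inter> U))"
    using homeomorphic_imp_open_map[OF U(4)] by (auto simp: open_map_def)
  then have "openin X (d ` (W \<inter> U))"
    using U(3) by (auto simp: openin_open_subtopology openin_unit_top_iff)
  then show "\<exists>T. openin X T \<and> x \<in> T \<and> T \<subseteq> d ` W" using g U by blast
qed

lemma open_rng:
  assumes "openin X W" shows "openin X (r ` W)"
  using open_dom[OF openin_inv_image[OF assms]] openin_arrows[OF assms] by simp

text \<open>Meant for \<open>d\<close> and \<open>r\<close>: these are continuous and open
  everywhere, so being a homeomorphism onto the image reduces to injectivity.\<close>

lemma homeomorphic_map_onto_units:
  assumes U: "openin X U" and inj: "inj_on f U"
    and cont: "continuous_map X (unit_top G) f" and op: "\<And>W. openin X W \<Longrightarrow> openin X (f ` W)"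
  shows "homeomorphic_map (subtopology X U) (subtopology (unit_top G) (f ` U)) f"
proof (rule bijective_open_imp_homeomorphic_map)
  have fU: "f ` U \<subseteq> units G"
    using cont openin_arrows[OF U] by (auto simp: continuous_map_def)
  have top: "topspace (subtopology X U) = U"
    "topspace (subtopology (unit_top G) (f ` U)) = f ` U"
    using openin_arrows[OF U] fU by auto
  then show "f ` topspace (subtopology X U) = topspace (subtopology (unit_top G) (f ` U))"
    and "inj_on f (topspace (subtopology X U))" using inj by simp_all
  show "continuous_map (subtopology X U) (subtopology (unit_top G) (f ` U)) f"
    using cont top by (auto simp: continuous_map_in_subtopology continuous_map_from_subtopology)
  have "openin (unit_top G) (f ` U)" using op[OF U] fU by (simp add: openin_unit_top_iff)
  then show "open_map (subtopology X U) (subtopology (unit_top G) (f ` U)) f"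
    using U fU op by (auto simp: open_map_def openin_open_subtopology openin_unit_top_iff)
qed

lemma local_bisection_iff:
  "local_bisection G U \<longleftrightarrow> openin X U \<and> inj_on d U \<and> inj_on r U"
proof
  assume L: "local_bisection G U"
  then have "openin X U" by (simp add: local_bisection_def)
  with L show "openin X U \<and> inj_on d U \<and> inj_on r U"
    using homeomorphic_imp_injective_map openin_arrows
    by (fastforce simp: local_bisection_def Int_absorb1)
next
  assume "openin X U \<and> inj_on d U \<and> inj_on r U"
  then show "local_bisection G U"
    unfolding local_bisection_def
    using homeomorphic_map_onto_units continuous_dom continuous_rng open_dom open_rng by auto
qed

section \<open>Compact open bisections\<close>

definition bisections :: "'a set set" where
  "bisections = {U. local_bisection G U \<and> compactin X U}"

lemma bisectionsD:
  assumes "U \<in> bisections"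
  shows "openin X U" "inj_on d U" "inj_on r U" "compactin X U" "U \<subseteq> arrows G"
  using assms openin_arrows by (auto simp: bisections_def local_bisection_iff)

lemma bisectionsI:
  "\<lbrakk>openin X U; inj_on d U; inj_on r U; compactin X U\<rbrakk> \<Longrightarrow> U \<in> bisections"
  by (auto simp: bisections_def local_bisection_iff)

lemma mem_bisection_arrow: "\<lbrakk>U \<in> bisections; g \<in> U\<rbrakk> \<Longrightarrow> g \<in> arrows G"
  using bisectionsD(5) by blast

lemma inj_on_inv_image:
  assumes "W \<subseteq> arrows G"
  shows "inj_on r W \<Longrightarrow> inj_on d (iv ` W)" "inj_on d W \<Longrightarrow> inj_on r (iv ` W)"
proof -
  have "inj_on (d \<circ> iv) W = inj_on r W" "inj_on (r \<circ> iv) W = inj_on d W"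
    by (rule inj_on_cong; use assms in force)+
  then show "inj_on r W \<Longrightarrow> inj_on d (iv ` W)" "inj_on d W \<Longrightarrow> inj_on r (iv ` W)"
    using inj_on_imageI by blast+
qed

lemma bisection_inv:
  assumes "U \<in> bisections" shows "iv ` U \<in> bisections"
proof (rule bisectionsI)
  note U = bisectionsD[OF assms]
  show "openin X (iv ` U)" using U openin_inv_image by blast
  show "compactin X (iv ` U)" using U continuous_inv image_compactin by blast
  show "inj_on d (iv ` U)" "inj_on r (iv ` U)"
    using U inj_on_inv_image by blast+
qed

lemma bisection_units:
  assumes "openin X V" "compactin X V" "V \<subseteq> units G" shows "V \<in> bisections"
  using assms dom_of_unit rng_of_unit by (intro bisectionsI) (auto simp: inj_on_def subset_iff)

lemma bisection_dom:
  assumes "U \<in> bisections"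
  shows "d ` U \<in> bisections" "d ` U \<subseteq> units G"
  using bisectionsD[OF assms] continuous_map_dom image_compactin open_dom
  by (auto intro!: bisection_units)

lemma bisection_rng:
  assumes "U \<in> bisections"
  shows "r ` U \<in> bisections" "r ` U \<subseteq> units G"
  using bisection_dom[OF bisection_inv[OF assms]] bisectionsD(5)[OF assms] by auto

text \<open>Compact sets of units are closed among the units only; compact subsets of the whole groupoid
  need not be closed.\<close>

lemma closed_units_imp_vimage:
  assumes "compactin X V" "V \<subseteq> units G" "f = d \<or> f = r"
  shows "closedin X {g \<in> arrows G. f g \<in> V}"
proof -
  have "closedin (unit_top G) V"
    using assms compactin_imp_closedin[OF units_Hausdorff] compactin_unit_top_iff by blast
  then show ?thesis
    using assms(3) continuous_dom continuous_rng by (auto simp: continuous_map_closedin)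
qed

text \<open>Injectivity of \<open>r\<close> near \<open>g\<close> is injectivity of \<open>d\<close>
  near \<open>iv g\<close>, transported by inversion; so the etale condition is used at both
  arrows.\<close>

lemma local_bisection_nbhd:
  assumes "openin X W" "g \<in> W"
  obtains U where "openin X U" "g \<in> U" "U \<subseteq> W" "inj_on d U" "inj_on r U"
proof -
  have g: "g \<in> arrows G" using assms openin_arrows by blast
  obtain A where A: "openin X A" "g \<in> A" "inj_on d A" using dom_homeomorphic_nbhd g by blast
  obtain B where B: "openin X B" "iv g \<in> B" "inj_on d B" using dom_homeomorphic_nbhd g inv_arrow by blast
  have "inj_on r (iv ` B)" using B openin_arrows[OF B(1)] inj_on_inv_image by blast
  moreover have "g \<in> iv ` B" using B g openin_arrows[OF B(1)] by simp
  ultimately show thesis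
    using A B assms openin_inv_image[OF B(1)]
    by (intro that[of "W \<inter> A \<inter> iv ` B"]) (auto intro: inj_on_subset)
qed

text \<open>The inverse of \<open>d\<close> on \<open>U\<close> when \<open>d\<close> is injective
  there. Being continuous, it lifts compact sets of units to compact sets of arrows.\<close>

definition dom_section :: "'a set \<Rightarrow> 'a \<Rightarrow> 'a" where
  "dom_section U = inv_into U d"

text \<open>The preimage of \<open>W\<close> under the section is the image under \<open>d\<close>
  of the intersection of \<open>U\<close> and \<open>W\<close>, which is open because
  \<open>d\<close> is an open map.\<close>

lemma continuous_map_dom_section:
  assumes U: "openin X U" "inj_on d U"
  shows "continuous_map (subtopology X (d ` U)) X (dom_section U)"
proof -
  have UG: "U \<subseteq> arrows G" "d ` U \<subseteq> arrows G" using openin_arrows U open_dom by blast+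
  have "openin (subtopology X (d ` U)) {x \<in> topspace (subtopology X (d ` U)). dom_section U x \<in> W}"
    if W: "openin X W" for W
  proof -
    have "{x \<in> topspace (subtopology X (d ` U)). dom_section U x \<in> W} = d ` (U \<inter> W)"
      using UG U by (auto simp: dom_section_def)
    then show ?thesis
      using open_dom[of U] open_dom[of "U \<inter> W"] U W by (auto simp: openin_open_subtopology)
  qed
  moreover have "dom_section U ` topspace (subtopology X (d ` U)) \<subseteq> topspace X"
    using UG U by (auto simp: dom_section_def)
  ultimately show ?thesis by (simp add: continuous_map)
qed

end

context ample_groupoid
begin

lemma compact_open_unit_nbhd:
  assumes "openin X W" "x \<in> W" "x \<in> units G"
  obtains V where "V \<in> bisections" "V \<subseteq> units G" "x \<in> V" "V \<subseteq> W"
proof -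
  obtain \<B> where \<B>: "\<forall>B \<in> \<B>. openin (unit_top G) B \<and> compactin (unit_top G) B"
    "\<forall>W. openin (unit_top G) W \<longrightarrow> (\<exists>\<B>'. \<B>' \<subseteq> \<B> \<and> \<Union>\<B>' = W)"
    using units_compact_open_basis by (elim exE conjE)
  have "openin (unit_top G) (W \<inter> units G)"
    using assms open_units by (auto simp: openin_unit_top_iff)
  with \<B>(2) obtain \<B>' where "\<B>' \<subseteq> \<B>" "\<Union>\<B>' = W \<inter> units G" by (elim allE[of _ "W \<inter> units G"]) auto
  then obtain V where "V \<in> \<B>" "x \<in> V" "V \<subseteq> W" using assms by blast
  then show thesis
    using bspec[OF \<B>(1), of V] that[of V] bisection_units
    by (auto simp: openin_unit_top_iff compactin_unit_top_iff)
qed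

text \<open>Compactness is lifted from the units: a compact open neighbourhood \<open>V\<close> of
  \<open>d g\<close> inside d(A) has as its image under the section of \<open>A\<close> exactly the
  arrows of \<open>A\<close> with domain in \<open>V\<close>. The first description gives
  compactness, the second openness.\<close>

lemma bisection_nbhd:
  assumes "openin X W" "g \<in> W"
  obtains U where "U \<in> bisections" "g \<in> U" "U \<subseteq> W"
proof -
  obtain A where A: "openin X A" "g \<in> A" "A \<subseteq> W" "inj_on d A" "inj_on r A"
    using local_bisection_nbhd[OF assms] by blast
  have AG: "A \<subseteq> arrows G" using A openin_arrows by blast
  have "d g \<in> d ` A" "d g \<in> units G" using A(2) AG by auto
  then obtain V where V: "V \<in> bisections" "V \<subseteq> units G" "d g \<in> V" "V \<subseteq> d ` A"
    using compact_open_unit_nbhd[OF open_dom[OF A(1)]] by metis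
  define U where "U = {g \<in> arrows G. d g \<in> V} \<inter> A"
  have "U = dom_section A ` V"
  proof (intro set_eqI iffI)
    fix h assume "h \<in> U"
    then show "h \<in> dom_section A ` V"
      using A(4) by (auto simp: U_def dom_section_def intro!: image_eqI[where x = "d h"])
  next
    fix h assume "h \<in> dom_section A ` V"
    then obtain x where x: "x \<in> V" "x \<in> d ` A" "h = inv_into A d x" using V(4) by (auto simp: dom_section_def)
    then have "h \<in> A" "d h = x" by (simp_all add: inv_into_into f_inv_into_f)
    then show "h \<in> U" using x AG by (auto simp: U_def)
  qed
  moreover have "compactin X (dom_section A ` V)"
    using continuous_map_dom_section[OF A(1,4)] V bisectionsD(4)
    by (intro image_compactin) (auto simp: compactin_subtopology)
  moreover have "openin X U" using V A by (auto simp: U_def bisectionsD intro!: openin_dom_vimage)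
  moreover have "inj_on d U" "inj_on r U" using A by (auto simp: U_def intro: inj_on_subset)
  ultimately have "U \<in> bisections" by (intro bisectionsI) auto
  moreover have "g \<in> U" "U \<subseteq> W" using A V AG by (auto simp: U_def)
  ultimately show thesis using that by blast
qed

end

section \<open>Products of bisections\<close>

context ample_groupoid
begin

lemma dom_section_dom [simp]: "\<lbrakk>U \<in> bisections; a \<in> U\<rbrakk> \<Longrightarrow> dom_section U (d a) = a"
  by (simp add: dom_section_def bisectionsD)

text \<open>The partial action of a bisection by left multiplication. It is meaningful only when
  \<open>r b\<close> lies in d(U); elsewhere \<open>dom_section\<close> takes an arbitrary
  value.\<close>

definition translate :: "'a set \<Rightarrow> 'a \<Rightarrow> 'a" where
  "translate U b = dom_section U (r b) \<cdot> b"

lemma translate_eq: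
  assumes "U \<in> bisections" "a \<in> U" "d a = r b"
  shows "translate U b = a \<cdot> b"
  using dom_section_dom[OF assms(1,2)] assms(3) by (simp add: translate_def)

lemma translate_inv_eq:
  assumes "U \<in> bisections" "a \<in> U" "r a = r b"
  shows "translate (iv ` U) b = iv a \<cdot> b"
  using assms bisection_inv[OF assms(1)] mem_bisection_arrow[OF assms(1,2)]
  by (intro translate_eq) auto

lemma continuous_map_translate:
  assumes U: "U \<in> bisections"
  shows "continuous_map (subtopology X {b \<in> arrows G. r b \<in> d ` U}) X (translate U)"
proof -
  let ?S = "{b \<in> arrows G. r b \<in> d ` U}"
  have r: "continuous_map (subtopology X ?S) (subtopology X (d ` U)) r"
    using continuous_map_rng by (auto simp: continuous_map_in_subtopology continuous_map_from_subtopology)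
  have "continuous_map (subtopology X ?S) X (dom_section U \<circ> r)"
    using r continuous_map_dom_section bisectionsD[OF U] by (blast intro: continuous_map_compose)
  then have "continuous_map (subtopology X ?S) (prod_topology X X) (\<lambda>b. (dom_section U (r b), b))"
    by (simp add: continuous_map_paired o_def continuous_map_from_subtopology)
  moreover have "(\<lambda>b. (dom_section U (r b), b)) ` ?S \<subseteq> composable G"
  proof clarify
    fix b a assume "b \<in> arrows G" "r b = d a" "a \<in> U"
    then show "(dom_section U (r b), b) \<in> composable G"
      using dom_section_dom[OF U, of a] mem_bisection_arrow[OF U, of a] by simp
  qed
  ultimately have "continuous_map (subtopology X ?S)
      (subtopology (prod_topology X X) (composable G)) (\<lambda>b. (dom_section U (r b), b))"
    by (auto simp: continuous_map_in_subtopology)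
  from continuous_map_compose[OF this continuous_mul] show ?thesis
    by (simp add: o_def translate_def[abs_def])
qed

definition setmul :: "'a set \<Rightarrow> 'a set \<Rightarrow> 'a set" where
  "setmul U W = {a \<cdot> b |a b. a \<in> U \<and> b \<in> W \<and> d a = r b}"

lemma setmulI: "\<lbrakk>a \<in> U; b \<in> W; d a = r b\<rbrakk> \<Longrightarrow> a \<cdot> b \<in> setmul U W"
  unfolding setmul_def by blast

lemma setmul_eq_translate_image:
  assumes U: "U \<in> bisections"
  shows "setmul U W = translate U ` {b \<in> W. r b \<in> d ` U}"
proof (intro set_eqI iffI)
  fix g assume "g \<in> setmul U W"
  then obtain a b where "g = a \<cdot> b" "a \<in> U" "b \<in> W" "d a = r b" by (auto simp: setmul_def)
  then show "g \<in> translate U ` {b \<in> W. r b \<in> d ` U}"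
    using translate_eq[OF U, of a b] imageI[of a U d] by (intro image_eqI[of _ _ b]) auto
next
  fix g assume "g \<in> translate U ` {b \<in> W. r b \<in> d ` U}"
  then obtain a b where "g = translate U b" "a \<in> U" "b \<in> W" "r b = d a" by auto
  then show "g \<in> setmul U W"
    using translate_eq[OF U, of a b] setmulI[of a U b W] by simp
qed

text \<open>Injectivity of \<open>r\<close> on \<open>U\<close> makes \<open>a\<close> the only
  possible left factor of \<open>g\<close> in \<open>U\<close>, and the right factor is then
  forced.\<close>

lemma mem_setmul_iff:
  assumes U: "U \<in> bisections" and W: "W \<subseteq> arrows G" and a: "a \<in> U" "r a = r g" and g: "g \<in> arrows G"
  shows "g \<in> setmul U W \<longleftrightarrow> iv a \<cdot> g \<in> W"
proof
  assume "g \<in> setmul U W"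
  then obtain a' b where ab: "g = a' \<cdot> b" "a' \<in> U" "b \<in> W" "d a' = r b" by (auto simp: setmul_def)
  then have arr: "a' \<in> arrows G" "b \<in> arrows G" using W mem_bisection_arrow[OF U] by auto
  then have "r a = r a'" using a ab by simp
  then have "a = a'" using inj_onD[OF bisectionsD(3)[OF U]] a ab by blast
  then show "iv a \<cdot> g \<in> W" using ab arr by simp
next
  assume "iv a \<cdot> g \<in> W"
  moreover have "a \<in> arrows G" using a mem_bisection_arrow[OF U] by blast
  ultimately show "g \<in> setmul U W"
    using a g setmulI[of a U "iv a \<cdot> g" W] by simp
qed

lemma rng_setmul:
  assumes "U \<subseteq> arrows G" "W \<subseteq> arrows G" "g \<in> setmul U W"
  shows "g \<in> arrows G" "r g \<in> r ` U" "d g \<in> d ` W"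
  using assms by (auto simp: setmul_def subset_iff)

text \<open>Left translation by the inverse bisection is continuous on the open set of arrows with
  range in r(U), and the product set is the preimage of \<open>W\<close> under it.\<close>

lemma open_setmul:
  assumes U: "U \<in> bisections" and W: "openin X W"
  shows "openin X (setmul U W)"
proof -
  let ?S = "{b \<in> arrows G. r b \<in> r ` U}"
  note UG = bisectionsD(5)[OF U] and WG = openin_arrows[OF W]
  have S: "openin X ?S" using open_rng[OF bisectionsD(1)[OF U]] openin_rng_vimage by blast
  have "continuous_map (subtopology X ?S) X (translate (iv ` U))"
    using continuous_map_translate[OF bisection_inv[OF U]] UG by simp
  then have "openin (subtopology X ?S) {g \<in> topspace (subtopology X ?S). translate (iv ` U) g \<in> W}"
    using W unfolding continuous_map by blast
  then have "openin X {g \<in> ?S. translate (iv ` U) g \<in> W}"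
    using S by (simp add: openin_open_subtopology Int_def conj_ac)
  moreover have "setmul U W = {g \<in> ?S. translate (iv ` U) g \<in> W}"
  proof (intro set_eqI)
    fix g
    show "g \<in> setmul U W \<longleftrightarrow> g \<in> {g \<in> ?S. translate (iv ` U) g \<in> W}"
    proof (cases "g \<in> arrows G \<and> r g \<in> r ` U")
      case True
      then obtain a where "a \<in> U" "r a = r g" by force
      then show ?thesis using True mem_setmul_iff[OF U WG] translate_inv_eq[OF U] by auto
    qed (use rng_setmul[OF UG WG] in auto)
  qed
  ultimately show ?thesis by simp
qed

text \<open>Only the arrows of \<open>V\<close> with range in d(U) can be multiplied; they form a
  compact set because d(U) is closed among the Hausdorff units, and translation maps this set onto
  the product. For injectivity, equal domains force equal right factors and then equal left factors;
  for ranges the order is reversed.\<close>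

lemma bisection_setmul:
  assumes U: "U \<in> bisections" and V: "V \<in> bisections"
  shows "setmul U V \<in> bisections"
proof (rule bisectionsI)
  note UG = bisectionsD[OF U] and VG = bisectionsD[OF V]
  show "openin X (setmul U V)" by (rule open_setmul[OF U VG(1)])
  have "closedin X {b \<in> arrows G. r b \<in> d ` U}"
    by (rule closed_units_imp_vimage[OF bisectionsD(4)]) (use bisection_dom[OF U] in auto)
  then have "compactin X (V \<inter> {b \<in> arrows G. r b \<in> d ` U})"
    by (rule compact_Int_closedin[OF VG(4)])
  moreover have eq: "{b \<in> V. r b \<in> d ` U} = V \<inter> {b \<in> arrows G. r b \<in> d ` U}" using VG by auto
  ultimately show "compactin X (setmul U V)"
    unfolding setmul_eq_translate_image[OF U] eq
    by (intro image_compactin[OF _ continuous_map_translate[OF U]]) (auto simp: compactin_subtopology)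
  have *: "a = a'" if "a \<in> U" "a' \<in> U" "r a = r a' \<or> d a = d a'" for a a'
    using that UG(2,3) by (auto dest: inj_onD)
  have **: "b = b'" if "b \<in> V" "b' \<in> V" "r b = r b' \<or> d b = d b'" for b b'
    using that VG(2,3) by (auto dest: inj_onD)
  have arr: "\<And>a. a \<in> U \<Longrightarrow> a \<in> arrows G" "\<And>a. a \<in> V \<Longrightarrow> a \<in> arrows G" using UG VG by auto
  show "inj_on d (setmul U V)"
  proof (rule inj_onI)
    fix g g' assume gg: "g \<in> setmul U V" "g' \<in> setmul U V" "d g = d g'"
    then obtain a b a' b' where ab: "g = a \<cdot> b" "a \<in> U" "b \<in> V" "d a = r b"
      "g' = a' \<cdot> b'" "a' \<in> U" "b' \<in> V" "d a' = r b'" by (auto simp: setmul_def)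
    then have "b = b'" using gg arr by (intro **) auto
    moreover from this have "a = a'" using ab arr by (intro *) auto
    ultimately show "g = g'" using ab by simp
  qed
  show "inj_on r (setmul U V)"
  proof (rule inj_onI)
    fix g g' assume gg: "g \<in> setmul U V" "g' \<in> setmul U V" "r g = r g'"
    then obtain a b a' b' where ab: "g = a \<cdot> b" "a \<in> U" "b \<in> V" "d a = r b"
      "g' = a' \<cdot> b'" "a' \<in> U" "b' \<in> V" "d a' = r b'" by (auto simp: setmul_def)
    then have "a = a'" using gg arr by (intro *) auto
    moreover from this have "b = b'" using ab arr by (intro **) auto
    ultimately show "g = g'" using ab by simp
  qed
qed

end

section \<open>Convolution in the Steinberg algebra\<close>

context groupoid
begin

text \<open>A factorization of \<open>g\<close> is determined by its left factor. Leaving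
  \<open>A\<close> free, as long as it covers the support of \<open>f\<close> in the fibre, lets one
  index set serve several functions at once.\<close>

lemma convolution_eq_sum:
  fixes f h :: "'g \<Rightarrow> 'k::comm_ring_1"
  assumes g: "g \<in> arrows G" and A: "finite A" "A \<subseteq> {a \<in> arrows G. r a = r g}"
    and f: "\<And>a. \<lbrakk>a \<in> arrows G; r a = r g; f a \<noteq> 0\<rbrakk> \<Longrightarrow> a \<in> A"
  shows "convolution G f h g = (\<Sum>a\<in>A. f a * h (iv a \<cdot> g))"
proof -
  let ?B = "{(\<alpha>, \<beta>). (\<alpha>, \<beta>) \<in> composable G \<and> \<alpha> \<cdot> \<beta> = g \<and> f \<alpha> * h \<beta> \<noteq> 0}"
  let ?p = "\<lambda>a. (a, iv a \<cdot> g)"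
  have "?B \<subseteq> ?p ` A"
  proof
    fix p assume "p \<in> ?B"
    then obtain a b where "p = (a, b)" "(a, b) \<in> composable G" "a \<cdot> b = g" "f a * h b \<noteq> 0" by blast
    then show "p \<in> ?p ` A" by (intro image_eqI[of _ _ a]) (auto intro!: f)
  qed
  then have "convolution G f h g = (\<Sum>(\<alpha>, \<beta>)\<in>?p ` A. f \<alpha> * h \<beta>)"
    unfolding convolution_def using A g by (intro sum.mono_neutral_left) auto
  also have "\<dots> = (\<Sum>a\<in>A. f a * h (iv a \<cdot> g))"
    by (subst sum.reindex) (simp_all add: inj_on_def)
  finally show ?thesis .
qed

lemma convolution_outside [simp]:
  assumes "g \<notin> arrows G" shows "convolution G f h g = 0"
proof -
  have "{(\<alpha>, \<beta>). (\<alpha>, \<beta>) \<in> composable G \<and> \<alpha> \<cdot> \<beta> = g \<and> f \<alpha> * h \<beta> \<noteq> 0} = {}" using assms by auto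
  then show ?thesis unfolding convolution_def by (simp only: sum.empty)
qed

text \<open>The linear involution induced by inversion of arrows, extended by zero. It reverses
  convolution products, so that facts about right multiplication follow from those about left
  multiplication.\<close>

definition flip :: "('g \<Rightarrow> 'k::comm_ring_1) \<Rightarrow> 'g \<Rightarrow> 'k" where
  "flip f g = (if g \<in> arrows G then f (iv g) else 0)"

lemma flip_flip:
  assumes "\<And>g. f g \<noteq> 0 \<Longrightarrow> g \<in> arrows G" shows "flip (flip f) = f"
  using assms by (auto simp: flip_def fun_eq_iff)

lemma flip_add: "flip (f + h) = flip f + flip h"
  and flip_scale: "flip (fun_scale c f) = fun_scale c (flip f)"
  and flip_zero [simp]: "flip 0 = 0"
  by (auto simp: flip_def fun_eq_iff fun_scale_def)

lemma flip_indicator: "U \<subseteq> arrows G \<Longrightarrow> flip (indicator U) = indicator (iv ` U)"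
  by (auto simp: flip_def fun_eq_iff indicator_def)

text \<open>Inverting and swapping the two factors matches the factorizations of \<open>iv g\<close>
  with those of \<open>g\<close>; commutativity of the coefficients reorders each summand.\<close>

lemma flip_convolution: "flip (convolution G f h) = convolution G (flip h) (flip f)"
proof
  fix g
  show "flip (convolution G f h) g = convolution G (flip h) (flip f) g"
  proof (cases "g \<in> arrows G")
    case True
    have "(\<Sum>(\<alpha>, \<beta>)\<in>{(\<alpha>, \<beta>). (\<alpha>, \<beta>) \<in> composable G \<and> \<alpha> \<cdot> \<beta> = iv g \<and> f \<alpha> * h \<beta> \<noteq> 0}. f \<alpha> * h \<beta>) =
        (\<Sum>(\<alpha>, \<beta>)\<in>{(\<alpha>, \<beta>). (\<alpha>, \<beta>) \<in> composable G \<and> \<alpha> \<cdot> \<beta> = g \<and> flip h \<alpha> * flip f \<beta> \<noteq> 0}. flip h \<alpha> * flip f \<beta>)"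
      using True
      by (intro sum.reindex_bij_witness[of _ "\<lambda>(a, b). (iv b, iv a)" "\<lambda>(a, b). (iv b, iv a)"])
        (auto simp: flip_def mult.commute inv_mul_distrib[symmetric])
    then show ?thesis using True by (simp add: flip_def convolution_def)
  qed (simp add: flip_def)
qed

end

section \<open>Convolution with indicators of bisections\<close>

context ample_groupoid
begin

text \<open>Since \<open>r\<close> is injective on \<open>U\<close>, the only arrow of
  \<open>U\<close> with the range of \<open>g\<close> is \<open>a\<close>, and the sum collapses to
  one term.\<close>

lemma convolution_indicator_left:
  assumes "U \<in> bisections" "a \<in> U" "g \<in> arrows G" "r a = r g"
  shows "convolution G (indicator U) f g = (f (iv a \<cdot> g) :: 'b::comm_ring_1)"
proof -
  have uniq: "x \<in> {a}" if "x \<in> arrows G" "r x = r g" "indicator U x \<noteq> (0 :: 'b)" for x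
    using that assms inj_onD[OF bisectionsD(3)[OF assms(1)], of x a] by (simp add: indicator_eq_0_iff)
  have "convolution G (indicator U) f g = (\<Sum>a\<in>{a}. indicator U a * f (iv a \<cdot> g))"
    using assms mem_bisection_arrow[OF assms(1,2)] by (intro convolution_eq_sum uniq) auto
  then show ?thesis using assms by simp
qed

lemma convolution_indicator_left_eq_0:
  assumes "U \<in> bisections" "r g \<notin> r ` U"
  shows "convolution G (indicator U) f g = 0"
proof (cases "g \<in> arrows G")
  case True
  have "convolution G (indicator U) f g = (\<Sum>a\<in>{}. indicator U a * f (iv a \<cdot> g))"
    using assms True by (intro convolution_eq_sum) (auto simp: indicator_def image_iff split: if_splits)
  then show ?thesis by simp
qed simp

lemma convolution_indicator_units_left:
  assumes "V \<in> bisections" "V \<subseteq> units G" "g \<in> arrows G"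
  shows "convolution G (indicator V) f g = (if r g \<in> V then f g else 0)"
proof (cases "r g \<in> V")
  case True
  then show ?thesis using assms convolution_indicator_left[of V "r g" g f] by simp
next
  case False
  have "r ` V = V" using assms(2) by (force simp: subset_iff image_iff)
  then show ?thesis using assms False convolution_indicator_left_eq_0[of V g f] by simp
qed

lemma convolution_indicator_indicator:
  assumes U: "U \<in> bisections" and V: "V \<in> bisections"
  shows "convolution G (indicator U) (indicator V) = (indicator (setmul U V) :: 'a \<Rightarrow> 'b::comm_ring_1)"
proof
  fix g
  note UG = bisectionsD(5)[OF U] and VG = bisectionsD(5)[OF V]
  show "convolution G (indicator U) (indicator V) g = (indicator (setmul U V) g :: 'b)"
  proof (cases "g \<in> arrows G \<and> r g \<in> r ` U")
    case True
    then obtain a where "a \<in> U" "r a = r g" by force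
    then show ?thesis
      using True mem_setmul_iff[OF U VG, of a g]
        convolution_indicator_left[OF U, of a g "indicator V :: _ \<Rightarrow> 'b"] by (simp add: indicator_def)
  next
    case False
    then have "g \<notin> setmul U V" using rng_setmul[OF UG VG] by blast
    then show ?thesis using False convolution_indicator_left_eq_0[OF U] by (auto simp: indicator_def)
  qed
qed

section \<open>Induction and closure properties of the span of indicators\<close>

lemma steinberg_functions_eq:
  "(steinberg_functions G :: ('a \<Rightarrow> 'k::comm_ring_1) set) = fun_module.span (indicator ` bisections)"
proof -
  have "{indicator U |U. local_bisection G U \<and> compactin X U} =
      (indicator ` bisections :: ('a \<Rightarrow> 'k::comm_ring_1) set)"
    by (auto simp: bisections_def)
  then show ?thesis by (simp only: steinberg_functions_def)
qed

text \<open>Adds one scaled indicator at a time and keeps the membership of the remainder, which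
  additivity of convolution and of fibre sums requires.\<close>

lemma steinberg_induct [consumes 1, case_names zero step]:
  assumes "f \<in> steinberg_functions G" "P 0"
    "\<And>U c f. \<lbrakk>U \<in> bisections; f \<in> steinberg_functions G; P f\<rbrakk> \<Longrightarrow> P (fun_scale c (indicator U) + f)"
  shows "P f"
proof -
  have "f \<in> fun_module.span (indicator ` bisections)" using assms(1) by (simp add: steinberg_functions_eq)
  then have "P f \<and> f \<in> steinberg_functions G"
  proof (induction rule: fun_module.span_induct_alt)
    case base
    have "P 0 \<and> 0 \<in> steinberg_functions G"
      using assms(2) by (simp add: steinberg_functions_eq fun_module.span_zero)
    then show ?case .
  next
    case (step c x y)
    then have "P (fun_scale c x + y) \<and> fun_scale c x + y \<in> steinberg_functions G"
      using assms(3)[of _ y c]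
      by (auto simp: steinberg_functions_eq simp del: plus_fun_apply
          intro!: fun_module.span_add fun_module.span_scale intro: fun_module.span_base)
    then show ?case .
  qed
  then show ?thesis by simp
qed

lemma steinberg_indicator: "U \<in> bisections \<Longrightarrow> indicator U \<in> steinberg_functions G"
  by (simp add: steinberg_functions_eq fun_module.span_base)

lemma steinberg_zero: "0 \<in> steinberg_functions G"
  and steinberg_add: "\<lbrakk>f \<in> steinberg_functions G; h \<in> steinberg_functions G\<rbrakk> \<Longrightarrow> f + h \<in> steinberg_functions G"
  and steinberg_diff: "\<lbrakk>f \<in> steinberg_functions G; h \<in> steinberg_functions G\<rbrakk> \<Longrightarrow> f - h \<in> steinberg_functions G"
  and steinberg_scale: "f \<in> steinberg_functions G \<Longrightarrow> fun_scale c f \<in> steinberg_functions G"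
  by (auto simp: steinberg_functions_eq fun_module.span_zero fun_module.span_add
      fun_module.span_diff fun_module.span_scale)

text \<open>A finite combination of indicators sees an arrow only through the bisections that
  contain it. Remembering this family instead of the coefficients is enough for finiteness of
  fibres, constancy on open subsets and the separation argument.\<close>

lemma steinberg_explicit:
  assumes "f \<in> steinberg_functions G"
  obtains F where "finite F" "F \<subseteq> bisections"
    "\<And>g h. (\<forall>U\<in>F. g \<in> U \<longleftrightarrow> h \<in> U) \<Longrightarrow> f g = f h" "\<And>g. f g \<noteq> 0 \<Longrightarrow> \<exists>U\<in>F. g \<in> U"
proof -
  have "\<exists>F. finite F \<and> F \<subseteq> bisections \<and> (\<forall>g h. (\<forall>U\<in>F. g \<in> U \<longleftrightarrow> h \<in> U) \<longrightarrow> f g = f h) \<and>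
      (\<forall>g. f g \<noteq> 0 \<longrightarrow> (\<exists>U\<in>F. g \<in> U))"
    using assms
  proof (induction rule: steinberg_induct)
    case zero
    show ?case by (rule exI[of _ "{}"]) simp
  next
    case (step U c f)
    then obtain F where F: "finite F" "F \<subseteq> bisections" "\<forall>g h. (\<forall>U\<in>F. g \<in> U \<longleftrightarrow> h \<in> U) \<longrightarrow> f g = f h"
      "\<forall>g. f g \<noteq> 0 \<longrightarrow> (\<exists>U\<in>F. g \<in> U)" by (elim exE conjE)
    have "(fun_scale c (indicator U) + f) g = (fun_scale c (indicator U) + f) h"
      if "\<forall>V\<in>insert U F. g \<in> V \<longleftrightarrow> h \<in> V" for g h
    proof -
      have "f g = f h" using that F(3) by simp
      then show ?thesis using that by (simp add: fun_scale_def indicator_def)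
    qed
    moreover have "\<exists>V\<in>insert U F. g \<in> V" if "(fun_scale c (indicator U) + f) g \<noteq> 0" for g
    proof (cases "g \<in> U")
      case False
      then show ?thesis using that F(4) by (simp add: fun_scale_def)
    qed simp
    ultimately show ?case using F(1,2) step(1) by (intro exI[of _ "insert U F"]) blast
  qed
  then show thesis using that by (elim exE conjE) blast
qed

lemma steinberg_support_arrows:
  assumes "f \<in> steinberg_functions G" "f g \<noteq> 0" shows "g \<in> arrows G"
  using steinberg_explicit[OF assms(1)] assms(2) mem_bisection_arrow by (metis subsetD)

text \<open>Each member of the finite family meets a fibre of \<open>d\<close> or \<open>r\<close>
  at most once.\<close>

lemma steinberg_finite_fibre:
  assumes "f \<in> steinberg_functions G" "k = d \<or> k = r"
  shows "finite {g \<in> arrows G. k g = x \<and> f g \<noteq> 0}"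
proof -
  obtain F where F: "finite F" "F \<subseteq> bisections" "\<And>g. f g \<noteq> 0 \<Longrightarrow> \<exists>U\<in>F. g \<in> U"
    using steinberg_explicit[OF assms(1)] by metis
  have "finite {g \<in> U. k g = x}" if "U \<in> F" for U
  proof -
    have "inj_on k U" using bisectionsD(2,3)[of U] F(2) that assms(2) by blast
    then have "inj_on k {g \<in> U. k g = x}" by (rule inj_on_subset) auto
    then show ?thesis by (rule inj_on_finite[of _ _ "{x}"]) auto
  qed
  then have "finite (\<Union>U\<in>F. {g \<in> U. k g = x})" using F(1) by blast
  then show ?thesis by (rule rev_finite_subset) (use F(3) in blast)
qed

lemma flip_steinberg:
  assumes "f \<in> steinberg_functions G" shows "flip f \<in> steinberg_functions G"
  using assms
proof (induction rule: steinberg_induct)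
  case (step U c f)
  then have "flip (fun_scale c (indicator U) + f) \<in> steinberg_functions G"
    by (simp add: flip_add flip_scale flip_indicator bisectionsD steinberg_add steinberg_scale
        steinberg_indicator bisection_inv)
  then show ?case .
qed (simp only: flip_zero steinberg_zero)

lemma flip_flip_steinberg: "f \<in> steinberg_functions G \<Longrightarrow> flip (flip f) = f"
  using flip_flip steinberg_support_arrows by metis

lemma convolution_add_left:
  assumes "f \<in> steinberg_functions G" "f' \<in> steinberg_functions G"
  shows "convolution G (f + f') h = convolution G f h + convolution G f' h"
proof
  fix g
  show "convolution G (f + f') h g = (convolution G f h + convolution G f' h) g"
  proof (cases "g \<in> arrows G")
    case True
    \<comment> \<open>One index set for all three sums; the support of \<open>f + f'\<close> can be
      smaller than this union through cancellation.\<close>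
    let ?A = "{a \<in> arrows G. r a = r g \<and> f a \<noteq> 0} \<union> {a \<in> arrows G. r a = r g \<and> f' a \<noteq> 0}"
    have A: "finite ?A" using steinberg_finite_fibre[where k=r] assms by blast
    have "convolution G f0 h g = (\<Sum>a\<in>?A. f0 a * h (iv a \<cdot> g))" if "f0 \<in> {f + f', f, f'}" for f0
      using A True that by (intro convolution_eq_sum) auto
    then show ?thesis by (simp add: distrib_right sum.distrib)
  qed simp
qed

lemma convolution_add_right:
  assumes "f \<in> steinberg_functions G"
  shows "convolution G f (h + h') = convolution G f h + convolution G f h'"
proof
  fix g
  show "convolution G f (h + h') g = (convolution G f h + convolution G f h') g"
  proof (cases "g \<in> arrows G")
    case True
    let ?A = "{a \<in> arrows G. r a = r g \<and> f a \<noteq> 0}"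
    have "convolution G f h0 g = (\<Sum>a\<in>?A. f a * h0 (iv a \<cdot> g))" for h0
      using True steinberg_finite_fibre[OF assms] by (intro convolution_eq_sum) auto
    then show ?thesis by (simp add: distrib_left sum.distrib)
  qed simp
qed

lemma convolution_scale:
  assumes "f \<in> steinberg_functions G"
  shows "convolution G (fun_scale c f) h = fun_scale c (convolution G f h)"
    and "convolution G f (fun_scale c h) = fun_scale c (convolution G f h)"
proof -
  have "convolution G (fun_scale c f) h g = fun_scale c (convolution G f h) g \<and>
    convolution G f (fun_scale c h) g = fun_scale c (convolution G f h) g" for g
  proof (cases "g \<in> arrows G")
    case True
    let ?A = "{a \<in> arrows G. r a = r g \<and> f a \<noteq> 0}"
    have "convolution G f0 h0 g = (\<Sum>a\<in>?A. f0 a * h0 (iv a \<cdot> g))" if "f0 \<in> {f, fun_scale c f}" for f0 h0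
      using True that steinberg_finite_fibre[OF assms]
      by (intro convolution_eq_sum) (auto simp: fun_scale_def)
    then show ?thesis by (simp add: fun_scale_def sum_distrib_left ac_simps)
  qed (simp add: fun_scale_def)
  then show "convolution G (fun_scale c f) h = fun_scale c (convolution G f h)"
    and "convolution G f (fun_scale c h) = fun_scale c (convolution G f h)" by auto
qed

lemma convolution_zero [simp]: "convolution G 0 h = 0" "convolution G f 0 = 0"
  by (simp_all add: convolution_def fun_eq_iff)

text \<open>Linearity in the left factor: for a fixed \<open>x\<close>, closure of \<open>J\<close>
  under sums and scalars reduces the claim to indicators of bisections.\<close>

lemma steinberg_left_mult_induct:
  assumes a: "a \<in> steinberg_functions G"
    and J: "0 \<in> J" "\<And>x y. x \<in> J \<Longrightarrow> y \<in> J \<Longrightarrow> x + y \<in> J" "\<And>c x. x \<in> J \<Longrightarrow> fun_scale c x \<in> J"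
      "\<And>U. U \<in> bisections \<Longrightarrow> convolution G (indicator U) x \<in> J"
  shows "convolution G a x \<in> J"
  using a
proof (induction rule: steinberg_induct)
  case (step U c f)
  then have "convolution G (fun_scale c (indicator U) + f) x \<in> J"
    by (simp add: convolution_add_left convolution_scale steinberg_scale steinberg_indicator J)
  then show ?case .
qed (simp only: convolution_zero J)

lemma steinberg_convolution:
  assumes f: "f \<in> steinberg_functions G" and h: "h \<in> steinberg_functions G"
  shows "convolution G f h \<in> steinberg_functions G"
  using f
proof (rule steinberg_left_mult_induct)
  fix U assume U: "U \<in> bisections"
  show "convolution G (indicator U) h \<in> steinberg_functions G"
    using h
  proof (induction rule: steinberg_induct)
    case (step V c h)
    then have "convolution G (indicator U) (fun_scale c (indicator V) + h) \<in> steinberg_functions G"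
      using U by (simp add: convolution_add_right convolution_scale steinberg_indicator steinberg_add
          steinberg_scale convolution_indicator_indicator bisection_setmul)
    then show ?case .
  qed (simp only: convolution_zero steinberg_zero)
qed (auto simp: steinberg_zero steinberg_add steinberg_scale)

text \<open>Closure under \<open>flip\<close> turns right products into left products with the
  factors reversed, so it remains to check left multiplication by indicators.\<close>

lemma two_sided_idealI:
  assumes "J \<subseteq> steinberg_functions G" "0 \<in> J" "\<And>x y. x \<in> J \<Longrightarrow> y \<in> J \<Longrightarrow> x + y \<in> J"
    "\<And>c x. x \<in> J \<Longrightarrow> fun_scale c x \<in> J"
    "\<And>U x. U \<in> bisections \<Longrightarrow> x \<in> J \<Longrightarrow> convolution G (indicator U) x \<in> J"
    "\<And>x. x \<in> J \<Longrightarrow> flip x \<in> J"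
  shows "two_sided_ideal (steinberg_algebra G) J"
proof -
  have left: "convolution G a x \<in> J" if "a \<in> steinberg_functions G" "x \<in> J" for a x
    using that(1) by (rule steinberg_left_mult_induct) (use assms that(2) in auto)
  have "convolution G x a \<in> J" if "a \<in> steinberg_functions G" "x \<in> J" for a x
  proof -
    have "flip (convolution G (flip a) (flip x)) \<in> J"
      using that by (intro assms(6) left flip_steinberg)
    then show ?thesis
      using that assms(1) by (simp add: flip_convolution flip_flip_steinberg subsetD)
  qed
  with left assms show ?thesis by (auto simp: two_sided_ideal_def steinberg_algebra_def)
qed

end

section \<open>Singular functions and sums over fibres\<close>

context ample_groupoid
begin

text \<open>The members of \<open>F\<close> are treated one at a time: the current open set either
  misses the next member or is replaced by its intersection with it.\<close>

lemma open_subset_deciding_finite_family: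
  assumes "finite F" "\<And>U. U \<in> F \<Longrightarrow> openin X U" "openin X W" "W \<noteq> {}"
  shows "\<exists>W'. openin X W' \<and> W' \<noteq> {} \<and> W' \<subseteq> W \<and> (\<forall>U\<in>F. W' \<subseteq> U \<or> W' \<inter> U = {})"
  using assms
proof (induction F)
  case (insert U F)
  then obtain W' where W': "openin X W'" "W' \<noteq> {}" "W' \<subseteq> W" "\<forall>U\<in>F. W' \<subseteq> U \<or> W' \<inter> U = {}"
    by auto
  show ?case
  proof (cases "W' \<inter> U = {}")
    case True
    then show ?thesis using W' by blast
  next
    case False
    then show ?thesis using W' insert.prems(1)[of U] by (intro exI[of _ "W' \<inter> U"]) auto
  qed
qed auto

lemma steinberg_constant_on_open_subset:
  assumes f: "f \<in> steinberg_functions G" and W: "openin X W" "W \<noteq> {}"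
  obtains W' c where "openin X W'" "W' \<noteq> {}" "W' \<subseteq> W" "\<And>g. g \<in> W' \<Longrightarrow> f g = c"
proof -
  obtain F where F: "finite F" "F \<subseteq> bisections"
    "\<And>g h. (\<forall>U\<in>F. g \<in> U \<longleftrightarrow> h \<in> U) \<Longrightarrow> f g = f h"
    using steinberg_explicit[OF f] by metis
  have "\<And>U. U \<in> F \<Longrightarrow> openin X U" using F(2) bisectionsD(1) by blast
  from open_subset_deciding_finite_family[OF F(1) this W]
  obtain W' where W': "openin X W'" "W' \<noteq> {}" "W' \<subseteq> W" "\<forall>U\<in>F. W' \<subseteq> U \<or> W' \<inter> U = {}" by blast
  then obtain g0 where "g0 \<in> W'" by blast
  then have "f g = f g0" if "g \<in> W'" for g using that W'(4) by (intro F(3)) blast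
  then show thesis using that W' by blast
qed

text \<open>On a smaller open set \<open>f\<close> is constant, and an empty interior of the support
  forces this constant to be 0. The resulting nowhere density passes to sums by shrinking
  twice.\<close>

lemma singular_iff:
  assumes f: "f \<in> steinberg_functions G"
  shows "f \<in> singular_functions G \<longleftrightarrow>
    (\<forall>W. openin X W \<and> W \<noteq> {} \<longrightarrow> (\<exists>W'. openin X W' \<and> W' \<noteq> {} \<and> W' \<subseteq> W \<and> (\<forall>g\<in>W'. f g = 0)))"
proof (intro iffI allI impI)
  fix W assume s: "f \<in> singular_functions G" and W: "openin X W \<and> W \<noteq> {}"
  then obtain W' c where W': "openin X W'" "W' \<noteq> {}" "W' \<subseteq> W" "\<And>g. g \<in> W' \<Longrightarrow> f g = c"
    using steinberg_constant_on_open_subset[OF f] by metis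
  moreover have "\<not> W' \<subseteq> {g \<in> arrows G. f g \<noteq> 0}"
    using s W' unfolding singular_functions_def interior_of_eq_empty by blast
  moreover have "W' \<subseteq> arrows G" using W' openin_arrows by blast
  ultimately have "\<forall>g\<in>W'. f g = 0" by auto
  with W' show "\<exists>W'. openin X W' \<and> W' \<noteq> {} \<and> W' \<subseteq> W \<and> (\<forall>g\<in>W'. f g = 0)" by blast
next
  assume *: "\<forall>W. openin X W \<and> W \<noteq> {} \<longrightarrow> (\<exists>W'. openin X W' \<and> W' \<noteq> {} \<and> W' \<subseteq> W \<and> (\<forall>g\<in>W'. f g = 0))"
  have "T = {}" if "openin X T" "T \<subseteq> {g \<in> arrows G. f g \<noteq> 0}" for T
  proof (rule ccontr)
    assume "T \<noteq> {}"
    with * that(1) obtain W' where "W' \<noteq> {}" "W' \<subseteq> T" "\<forall>g\<in>W'. f g = 0" by metis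
    with that(2) show False by blast
  qed
  then show "f \<in> singular_functions G"
    using f unfolding singular_functions_def interior_of_eq_empty by blast
qed

lemma singular_zero_on_open_subset:
  assumes "f \<in> singular_functions G" "openin X W" "W \<noteq> {}"
  obtains W' where "openin X W'" "W' \<noteq> {}" "W' \<subseteq> W" "\<forall>g\<in>W'. f g = 0"
proof -
  have "f \<in> steinberg_functions G" using assms(1) by (simp add: singular_functions_def)
  from iffD1[OF singular_iff[OF this] assms(1), rule_format, OF conjI[OF assms(2,3)]]
  show thesis using that by (elim exE conjE)
qed

lemma singularI:
  assumes "f \<in> steinberg_functions G"
    "\<And>W g. \<lbrakk>openin X W; g \<in> W; \<And>g. g \<in> W \<Longrightarrow> f g \<noteq> 0\<rbrakk> \<Longrightarrow> False"
  shows "f \<in> singular_functions G"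
proof -
  have "T = {}" if "openin X T" "T \<subseteq> {g \<in> arrows G. f g \<noteq> 0}" for T
    using assms(2)[OF that(1)] that(2) by blast
  then show ?thesis using assms(1) unfolding singular_functions_def interior_of_eq_empty by blast
qed

lemma singularD:
  assumes "f \<in> singular_functions G"
  shows "f \<in> steinberg_functions G" "\<lbrakk>openin X W; W \<noteq> {}; \<And>g. g \<in> W \<Longrightarrow> f g \<noteq> 0\<rbrakk> \<Longrightarrow> False"
proof -
  show f: "f \<in> steinberg_functions G" using assms by (simp add: singular_functions_def)
  assume W: "openin X W" "W \<noteq> {}" "\<And>g. g \<in> W \<Longrightarrow> f g \<noteq> 0"
  then obtain W' where "W' \<noteq> {}" "W' \<subseteq> W" "\<forall>g\<in>W'. f g = 0"
    using singular_zero_on_open_subset[OF assms W(1,2)] by metis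
  with W(3) show False by blast
qed

lemma singular_add:
  assumes "f \<in> singular_functions G" "h \<in> singular_functions G"
  shows "f + h \<in> singular_functions G"
proof -
  have st: "f \<in> steinberg_functions G" "h \<in> steinberg_functions G" "f + h \<in> steinberg_functions G"
    using assms singularD(1) steinberg_add by blast+
  show ?thesis
    unfolding singular_iff[OF st(3)]
  proof (intro allI impI)
    fix W assume "openin X W \<and> W \<noteq> {}"
    then obtain W1 where "openin X W1" "W1 \<noteq> {}" "W1 \<subseteq> W" "\<forall>g\<in>W1. f g = 0"
      using assms(1) unfolding singular_iff[OF st(1)] by metis
    moreover then obtain W2 where "openin X W2" "W2 \<noteq> {}" "W2 \<subseteq> W1" "\<forall>g\<in>W2. h g = 0"
      using assms(2) unfolding singular_iff[OF st(2)] by metis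
    ultimately show "\<exists>W'. openin X W' \<and> W' \<noteq> {} \<and> W' \<subseteq> W \<and> (\<forall>g\<in>W'. (f + h) g = 0)"
      by (intro exI[of _ W2]) auto
  qed
qed

lemma two_sided_ideal_singular:
  "two_sided_ideal (steinberg_algebra G) (singular_functions G :: ('a \<Rightarrow> 'k::comm_ring_1) set)"
proof (rule two_sided_idealI)
  show "singular_functions G \<subseteq> (steinberg_functions G :: ('a \<Rightarrow> 'k) set)" using singularD(1) by blast
  show "(0 :: 'a \<Rightarrow> 'k) \<in> singular_functions G" by (rule singularI) (auto simp: steinberg_zero)
  fix x y :: "'a \<Rightarrow> 'k" and c :: 'k and U
  assume x: "x \<in> singular_functions G"
  note xs = singularD(1)[OF x]
  show "x + y \<in> singular_functions G" if "y \<in> singular_functions G" using x that by (rule singular_add)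
  show "fun_scale c x \<in> singular_functions G"
  proof (rule singularI)
    fix W g assume "openin X W" "g \<in> W" "\<And>g. g \<in> W \<Longrightarrow> fun_scale c x g \<noteq> 0"
    moreover then have "x h \<noteq> 0" if "h \<in> W" for h using that by (force simp: fun_scale_def)
    ultimately show False using singularD(2)[OF x, of W] by blast
  qed (use xs in \<open>rule steinberg_scale\<close>)
  show "flip x \<in> singular_functions G"
  proof (rule singularI)
    fix W g assume W: "openin X W" "g \<in> W" "\<And>g. g \<in> W \<Longrightarrow> flip x g \<noteq> 0"
    have "x h \<noteq> 0" if "h \<in> iv ` W" for h
    proof -
      have h: "h \<in> arrows G" "iv h \<in> W" using that openin_arrows[OF W(1)] by auto
      then show ?thesis using W(3)[OF h(2)] by (simp add: flip_def)
    qed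
    then show False using singularD(2)[OF x openin_inv_image[OF W(1)]] W(2) by blast
  qed (use xs in \<open>rule flip_steinberg\<close>)
  assume U: "U \<in> bisections"
  show "convolution G (indicator U) x \<in> singular_functions G"
  proof (rule singularI)
    fix W g assume W: "openin X W" "g \<in> W" "\<And>g. g \<in> W \<Longrightarrow> convolution G (indicator U) x g \<noteq> 0"
    note WG = openin_arrows[OF W(1)]
    have conv: "x (iv a \<cdot> h) \<noteq> 0" if "a \<in> U" "h \<in> W" "r a = r h" for a h
      using W(3)[OF that(2)] convolution_indicator_left[OF U that(1) _ that(3), of x] WG that(2) by auto
    \<comment> \<open>If the product vanishes nowhere on \<open>W\<close>, then \<open>x\<close>
      vanishes nowhere on the product of the inverse of \<open>U\<close> with \<open>W\<close>,
      which is open.\<close>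
    have "x h \<noteq> 0" if "h \<in> setmul (iv ` U) W" for h
      using that conv mem_bisection_arrow[OF U] by (auto simp: setmul_def)
    moreover have "openin X (setmul (iv ` U) W)" using bisection_inv[OF U] W(1) by (rule open_setmul)
    \<comment> \<open>The product set is nonempty, because the convolution is zero at arrows whose
      range lies outside r(U).\<close>
    moreover obtain a where "a \<in> U" "r a = r g"
      using W(3)[OF W(2)] convolution_indicator_left_eq_0[OF U, of g x] by force
    then have "iv a \<cdot> g \<in> setmul (iv ` U) W"
      using W(2) mem_bisection_arrow[OF U] by (intro setmulI) auto
    ultimately show False using singularD(2)[OF x] by blast
  qed (use U xs in \<open>simp add: steinberg_convolution steinberg_indicator\<close>)
qed

section \<open>Fibre sums\<close>

definition fibre_sum :: "('a \<Rightarrow> 'k::comm_ring_1) \<Rightarrow> 'a \<Rightarrow> 'a \<Rightarrow> 'k" where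
  "fibre_sum f y z = (\<Sum>g\<in>{g \<in> arrows G. r g = y \<and> d g = z \<and> f g \<noteq> 0}. f g)"

text \<open>As in \<open>fibre_sum\<close>, only nonzero values are summed, since a sum over an
  infinite fibre would default to 0. Summing over all ranges at once is what makes the result
  locally constant in \<open>z\<close>.\<close>

definition dom_sum :: "('a \<Rightarrow> 'k::comm_ring_1) \<Rightarrow> 'a \<Rightarrow> 'k" where
  "dom_sum f z = (\<Sum>g\<in>{g \<in> arrows G. d g = z \<and> f g \<noteq> 0}. f g)"

lemma finite_dom_fibre:
  assumes "f \<in> steinberg_functions G"
  shows "finite {g \<in> arrows G. d g = z \<and> f g \<noteq> 0}"
    and "finite {g \<in> arrows G. r g = y \<and> d g = z \<and> f g \<noteq> 0}"
proof -
  show fin: "finite {g \<in> arrows G. d g = z \<and> f g \<noteq> 0}" using steinberg_finite_fibre[OF assms] by simp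
  show "finite {g \<in> arrows G. r g = y \<and> d g = z \<and> f g \<noteq> 0}" by (rule finite_subset[OF _ fin]) auto
qed

lemma fibre_sum_add:
  assumes f: "f \<in> steinberg_functions G" and h: "h \<in> steinberg_functions G"
  shows "fibre_sum (f + h) y z = fibre_sum f y z + fibre_sum h y z"
proof -
  let ?A = "{g \<in> arrows G. r g = y \<and> d g = z \<and> f g \<noteq> 0} \<union> {g \<in> arrows G. r g = y \<and> d g = z \<and> h g \<noteq> 0}"
  have "finite ?A" using finite_dom_fibre f h by blast
  then have "fibre_sum k y z = sum k ?A" if "k \<in> {f, h, f + h}" for k
    unfolding fibre_sum_def using that by (intro sum.mono_neutral_left) auto
  then show ?thesis by (simp add: sum.distrib)
qed

lemma dom_sum_add:
  assumes f: "f \<in> steinberg_functions G" and h: "h \<in> steinberg_functions G"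
  shows "dom_sum (f + h) z = dom_sum f z + dom_sum h z"
proof -
  let ?A = "{g \<in> arrows G. d g = z \<and> f g \<noteq> 0} \<union> {g \<in> arrows G. d g = z \<and> h g \<noteq> 0}"
  have "finite ?A" using finite_dom_fibre f h by blast
  then have "dom_sum k z = sum k ?A" if "k \<in> {f, h, f + h}" for k
    unfolding dom_sum_def using that by (intro sum.mono_neutral_left) auto
  then show ?thesis by (simp add: sum.distrib)
qed

lemma fibre_sum_scale:
  assumes f: "f \<in> steinberg_functions G"
  shows "fibre_sum (fun_scale c f) y z = c * fibre_sum f y z"
proof -
  let ?A = "{g \<in> arrows G. r g = y \<and> d g = z \<and> f g \<noteq> 0}"
  have "fibre_sum (fun_scale c f) y z = sum (fun_scale c f) ?A"
    unfolding fibre_sum_def using finite_dom_fibre[OF f]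
    by (intro sum.mono_neutral_left) (auto simp: fun_scale_def)
  then show ?thesis by (simp add: fibre_sum_def fun_scale_def sum_distrib_left)
qed

lemma dom_sum_scale:
  assumes f: "f \<in> steinberg_functions G"
  shows "dom_sum (fun_scale c f) z = c * dom_sum f z"
proof -
  let ?A = "{g \<in> arrows G. d g = z \<and> f g \<noteq> 0}"
  have "dom_sum (fun_scale c f) z = sum (fun_scale c f) ?A"
    unfolding dom_sum_def using finite_dom_fibre[OF f]
    by (intro sum.mono_neutral_left) (auto simp: fun_scale_def)
  then show ?thesis by (simp add: dom_sum_def fun_scale_def sum_distrib_left)
qed

lemma fibre_sum_flip: "fibre_sum (flip f) y z = fibre_sum f z y"
  unfolding fibre_sum_def
  by (rule sum.reindex_bij_witness[of _ iv iv]) (auto simp: flip_def)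

lemma fibre_sum_indicator:
  assumes U: "U \<in> bisections"
  shows "fibre_sum (indicator U) y z = of_bool (\<exists>g\<in>U. r g = y \<and> d g = z)"
proof (cases "\<exists>g\<in>U. r g = y \<and> d g = z")
  case True
  then obtain g where g: "g \<in> U" "r g = y" "d g = z" by blast
  have "h \<in> arrows G \<and> r h = y \<and> d h = z \<and> indicator U h \<noteq> (0::'b) \<longleftrightarrow> h = g" for h
    using g mem_bisection_arrow[OF U g(1)] inj_onD[OF bisectionsD(2)[OF U], of h g]
    by (auto simp: indicator_eq_0_iff)
  then have "{g \<in> arrows G. r g = y \<and> d g = z \<and> indicator U g \<noteq> (0::'b)} = {g}" by blast
  then show ?thesis using g unfolding fibre_sum_def by auto
next
  case False
  then have "{g \<in> arrows G. r g = y \<and> d g = z \<and> indicator U g \<noteq> (0::'b)} = {}"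
    by (auto simp: indicator_eq_0_iff)
  then show ?thesis using False unfolding fibre_sum_def by auto
qed

lemma dom_sum_indicator:
  assumes U: "U \<in> bisections"
  shows "dom_sum (indicator U) z = indicator (d ` U) z"
proof (cases "z \<in> d ` U")
  case True
  then obtain g where g: "g \<in> U" "d g = z" by blast
  have "h \<in> arrows G \<and> d h = z \<and> indicator U h \<noteq> (0::'b) \<longleftrightarrow> h = g" for h
    using g mem_bisection_arrow[OF U g(1)] inj_onD[OF bisectionsD(2)[OF U], of h g]
    by (auto simp: indicator_eq_0_iff)
  then have "{g \<in> arrows G. d g = z \<and> indicator U g \<noteq> (0::'b)} = {g}" by blast
  then show ?thesis using g unfolding dom_sum_def by auto
next
  case False
  then have "{g \<in> arrows G. d g = z \<and> indicator U g \<noteq> (0::'b)} = {}"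
    by (auto simp: indicator_eq_0_iff)
  then show ?thesis using False unfolding dom_sum_def by auto
qed

text \<open>Left multiplication by \<open>a\<close> maps the arrows from \<open>z\<close> to
  \<open>d a\<close> bijectively onto those from \<open>z\<close> to \<open>r a\<close>, and the
  convolution at such a product has the value of \<open>f\<close> at the right factor.\<close>

lemma fibre_sum_convolution:
  assumes U: "U \<in> bisections" and a: "a \<in> U"
  shows "fibre_sum (convolution G (indicator U) f) (r a) z = fibre_sum f (d a) z"
proof -
  have "convolution G (indicator U) f g = f (iv a \<cdot> g)" if "g \<in> arrows G" "r g = r a" for g
    by (rule convolution_indicator_left[OF U a that(1) that(2)[symmetric]])
  then show ?thesis
    unfolding fibre_sum_def using mem_bisection_arrow[OF U a]
    by (intro sum.reindex_bij_witness[of _ "\<lambda>b. a \<cdot> b" "\<lambda>g. iv a \<cdot> g"]) auto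
qed

lemma fibre_sum_convolution_eq_0:
  assumes U: "U \<in> bisections" and y: "y \<notin> r ` U"
  shows "fibre_sum (convolution G (indicator U) f) y z = 0"
proof -
  have "{g \<in> arrows G. r g = y \<and> d g = z \<and> convolution G (indicator U) f g \<noteq> 0} = {}"
    using convolution_indicator_left_eq_0[OF U, of _ f] y by auto
  then show ?thesis unfolding fibre_sum_def by (simp only: sum.empty)
qed

lemma open_units_minus:
  assumes "compactin X K" "K \<subseteq> units G" shows "openin X (units G - K)"
proof -
  have "closedin (unit_top G) K"
    using assms compactin_imp_closedin[OF units_Hausdorff] compactin_unit_top_iff by blast
  then have "openin (unit_top G) (units G - K)" using openin_diff[of "unit_top G" "units G" K]
    by (metis openin_topspace topspace_unit_top)
  then show ?thesis by (simp add: openin_unit_top_iff)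
qed

text \<open>For a single bisection the sum is the indicator of d(U), a compact open set and hence
  clopen in the Hausdorff unit space. Each induction step intersects with d(U) or its complement,
  whichever contains \<open>x\<close>.\<close>

lemma dom_sum_locally_constant:
  assumes "f \<in> steinberg_functions G" and x: "x \<in> units G"
  shows "\<exists>N. openin X N \<and> x \<in> N \<and> N \<subseteq> units G \<and> (\<forall>y\<in>N. dom_sum f y = dom_sum f x)"
  using assms(1)
proof (induction rule: steinberg_induct)
  case zero
  have "\<exists>N. openin X N \<and> x \<in> N \<and> N \<subseteq> units G \<and> (\<forall>y\<in>N. dom_sum 0 y = dom_sum 0 x)"
    using open_units x by (intro exI[of _ "units G"]) (auto simp: dom_sum_def)
  then show ?case .
next
  case (step U c f)
  then obtain N where N: "openin X N" "x \<in> N" "N \<subseteq> units G" "\<forall>y\<in>N. dom_sum f y = dom_sum f x" by auto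
  let ?M = "if x \<in> d ` U then d ` U else units G - d ` U"
  have M: "openin X ?M" "x \<in> ?M"
    using bisection_dom[OF step(1)] bisectionsD(1,4) open_units_minus x by auto
  have "dom_sum (fun_scale c (indicator U) + f) y = dom_sum (fun_scale c (indicator U) + f) x"
    if "y \<in> N \<inter> ?M" for y
  proof -
    have "dom_sum (fun_scale c (indicator U) + f) w = c * indicator (d ` U) w + dom_sum f w" for w
      using step(1,2) by (simp add: dom_sum_add dom_sum_scale dom_sum_indicator steinberg_scale steinberg_indicator)
    then show ?thesis using N(4) that by (auto simp: indicator_def split: if_splits)
  qed
  then have "\<exists>N. openin X N \<and> x \<in> N \<and> N \<subseteq> units G \<and> (\<forall>y\<in>N.
      dom_sum (fun_scale c (indicator U) + f) y = dom_sum (fun_scale c (indicator U) + f) x)"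
    using N M by (intro exI[of _ "N \<inter> ?M"] conjI openin_Int ballI) blast+
  then show ?case .
qed

text \<open>One bisection at a time, an open set of zeros of \<open>f\<close> inside
  \<open>U\<close> is pushed down by \<open>d\<close>. Injectivity of \<open>d\<close> on
  \<open>U\<close> ensures that every arrow of \<open>U\<close> starting in the smaller set of units
  is one of these zeros.\<close>

lemma singular_avoids_fibres:
  assumes f: "f \<in> singular_functions G" and F: "finite F" "F \<subseteq> bisections"
    and N: "openin X N" "N \<noteq> {}" "N \<subseteq> units G"
  shows "\<exists>N'. openin X N' \<and> N' \<noteq> {} \<and> N' \<subseteq> N \<and> (\<forall>U\<in>F. \<forall>g\<in>U. d g \<in> N' \<longrightarrow> f g = 0)"
  using F
proof (induction F)
  case empty
  then show ?case using N by auto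
next
  case (insert U F)
  then obtain N1 where N1: "openin X N1" "N1 \<noteq> {}" "N1 \<subseteq> N" "\<forall>U\<in>F. \<forall>g\<in>U. d g \<in> N1 \<longrightarrow> f g = 0"
    by auto
  have U: "U \<in> bisections" using insert.prems by simp
  let ?W = "{g \<in> arrows G. d g \<in> N1} \<inter> U"
  have W: "openin X ?W" using N1(1) bisectionsD(1)[OF U] openin_dom_vimage by blast
  show ?case
  proof (cases "?W = {}")
    case True
    then have "\<forall>g\<in>U. d g \<in> N1 \<longrightarrow> f g = 0" using mem_bisection_arrow[OF U] by blast
    then show ?thesis using N1 by (intro exI[of _ N1]) auto
  next
    case False
    obtain W' where W': "openin X W'" "W' \<noteq> {}" "W' \<subseteq> ?W" "\<forall>g\<in>W'. f g = 0"
      by (rule singular_zero_on_open_subset[OF f W False])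
    have "f g = 0" if g: "g \<in> U" "d g \<in> d ` W'" for g
    proof -
      obtain h where h: "h \<in> W'" "d g = d h" using g(2) by blast
      then have "g = h" using inj_onD[OF bisectionsD(2)[OF U]] W'(3) g(1) by blast
      then show ?thesis using W'(4) h(1) by blast
    qed
    moreover have "d ` W' \<subseteq> N1" using W'(3) by blast
    ultimately show ?thesis using N1 W' open_dom[OF W'(1)] by (intro exI[of _ "d ` W'"]) auto
  qed
qed

text \<open>Local constancy moves the computation from \<open>x\<close> to a nearby unit
  \<open>y\<close> at which no arrow of the support starts.\<close>

lemma dom_sum_singular:
  assumes f: "f \<in> singular_functions G" and x: "x \<in> units G"
  shows "dom_sum f x = 0"
proof -
  note fs = singularD(1)[OF f]
  obtain N where N: "openin X N" "x \<in> N" "N \<subseteq> units G" "\<forall>y\<in>N. dom_sum f y = dom_sum f x"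
    using dom_sum_locally_constant[OF fs x] by blast
  obtain F where F: "finite F" "F \<subseteq> bisections" "\<And>g. f g \<noteq> 0 \<Longrightarrow> \<exists>U\<in>F. g \<in> U"
    using steinberg_explicit[OF fs] by metis
  obtain N' where N': "N' \<noteq> {}" "N' \<subseteq> N" "\<forall>U\<in>F. \<forall>g\<in>U. d g \<in> N' \<longrightarrow> f g = 0"
    using singular_avoids_fibres[OF f F(1,2) N(1) _ N(3)] N(2) by blast
  then obtain y where y: "y \<in> N'" by blast
  have "{g \<in> arrows G. d g = y \<and> f g \<noteq> 0} = {}" using F(3) N'(3) y by blast
  then have "dom_sum f y = 0" unfolding dom_sum_def by (simp only: sum.empty)
  then show ?thesis using N(4) N'(2) y by auto
qed

text \<open>Cutting \<open>f\<close> down to a small neighbourhood of \<open>y\<close> turns the sum over the arrows from \<open>z\<close> to \<open>y\<close>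
  into the sum over all arrows starting at \<open>z\<close>.\<close>

lemma fibre_sum_singular:
  assumes f: "f \<in> singular_functions G"
  shows "fibre_sum f y z = 0"
proof (cases "y \<in> units G \<and> z \<in> units G")
  case False
  then have "{g \<in> arrows G. r g = y \<and> d g = z \<and> f g \<noteq> 0} = {}" by auto
  then show ?thesis unfolding fibre_sum_def by (simp only: sum.empty)
next
  case True
  \<comment> \<open>The unwanted ranges. They are finite in number, so their complement is an open
    neighbourhood of \<open>y\<close> among the units.\<close>
  define P where "P = r ` {g \<in> arrows G. d g = z \<and> f g \<noteq> 0} - {y}"
  have "finite P" "P \<subseteq> units G"
    using finite_dom_fibre[OF singularD(1)[OF f]] by (auto simp: P_def)
  then have "openin X (units G - P)"
    by (intro open_units_minus finite_imp_compactin) auto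
  moreover have "y \<in> units G - P" using True by (simp add: P_def)
  ultimately obtain V where V: "V \<in> bisections" "V \<subseteq> units G" "y \<in> V" "V \<subseteq> units G - P"
    using compact_open_unit_nbhd True by metis
  let ?f = "convolution G (indicator V) f"
  have "?f \<in> singular_functions G"
    using two_sided_ideal_singular f steinberg_indicator[OF V(1)]
    unfolding two_sided_ideal_def steinberg_algebra_def by auto
  then have "dom_sum ?f z = 0" using dom_sum_singular True by blast
  moreover have "dom_sum ?f z = fibre_sum f y z"
    unfolding dom_sum_def fibre_sum_def
    using V(3,4) by (intro sum.cong) (auto simp: convolution_indicator_units_left[OF V(1,2)] P_def split: if_splits)
  ultimately show ?thesis by simp
qed

section \<open>The kernel of the action on an invariant set of units\<close>

definition fibre_sum_kernel :: "'a set \<Rightarrow> ('a \<Rightarrow> 'k::comm_ring_1) set" where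
  "fibre_sum_kernel S = {f \<in> steinberg_functions G. \<forall>y\<in>S. \<forall>z\<in>S. fibre_sum f y z = 0}"

text \<open>Left multiplication by a bisection moves the row \<open>d a\<close> to the row
  \<open>r a\<close>, and invariance keeps both inside \<open>S\<close> or both outside;
  \<open>flip\<close> transposes the coefficients.\<close>

lemma two_sided_ideal_fibre_sum_kernel:
  assumes inv: "\<And>g. g \<in> arrows G \<Longrightarrow> d g \<in> S \<longleftrightarrow> r g \<in> S"
  shows "two_sided_ideal (steinberg_algebra G) (fibre_sum_kernel S)"
proof (rule two_sided_idealI)
  fix U x assume U: "U \<in> bisections" and x: "x \<in> fibre_sum_kernel S"
  have "fibre_sum (convolution G (indicator U) x) y z = 0" if "y \<in> S" "z \<in> S" for y z
  proof (cases "y \<in> r ` U")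
    case True
    then obtain a where a: "a \<in> U" "y = r a" by blast
    then show ?thesis
      using that x inv[OF mem_bisection_arrow[OF U a(1)]] fibre_sum_convolution[OF U a(1), of x]
      by (simp add: fibre_sum_kernel_def)
  qed (rule fibre_sum_convolution_eq_0[OF U])
  then show "convolution G (indicator U) x \<in> fibre_sum_kernel S"
    using x U by (simp add: fibre_sum_kernel_def steinberg_convolution steinberg_indicator)
qed (auto simp: fibre_sum_kernel_def steinberg_zero steinberg_add steinberg_scale flip_steinberg
    fibre_sum_add fibre_sum_scale fibre_sum_flip simp del: plus_fun_apply, simp add: fibre_sum_def)

lemma singular_subset_fibre_sum_kernel: "singular_functions G \<subseteq> fibre_sum_kernel S"
  using singularD(1) fibre_sum_singular by (auto simp: fibre_sum_kernel_def)

end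

section \<open>Simple quotients\<close>

text \<open>The laws under which the unions of cosets in \<open>quotient_algebra\<close> collapse to
  the operations on representatives; \<open>smult_minus_one\<close> makes ideals closed under
  negation.\<close>

locale algebra_ideal =
  fixes A :: "('k::comm_ring_1, 'a::ab_group_add) nu_algebra" and I :: "'a set"
  assumes zero_eq: "alg_zero A = 0" and add_eq: "alg_add A = (+)"
    and carrier_add: "\<lbrakk>x \<in> alg_carrier A; y \<in> alg_carrier A\<rbrakk> \<Longrightarrow> x + y \<in> alg_carrier A"
    and carrier_smult: "x \<in> alg_carrier A \<Longrightarrow> alg_smult A c x \<in> alg_carrier A"
    and carrier_mult: "\<lbrakk>x \<in> alg_carrier A; y \<in> alg_carrier A\<rbrakk> \<Longrightarrow> alg_mult A x y \<in> alg_carrier A"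
    and smult_add: "\<lbrakk>x \<in> alg_carrier A; y \<in> alg_carrier A\<rbrakk> \<Longrightarrow>
      alg_smult A c (x + y) = alg_smult A c x + alg_smult A c y"
    and smult_minus_one: "x \<in> alg_carrier A \<Longrightarrow> alg_smult A (- 1) x = - x"
    and mult_add_left: "\<lbrakk>x \<in> alg_carrier A; y \<in> alg_carrier A; z \<in> alg_carrier A\<rbrakk> \<Longrightarrow>
      alg_mult A (x + y) z = alg_mult A x z + alg_mult A y z"
    and mult_add_right: "\<lbrakk>x \<in> alg_carrier A; y \<in> alg_carrier A; z \<in> alg_carrier A\<rbrakk> \<Longrightarrow>
      alg_mult A x (y + z) = alg_mult A x y + alg_mult A x z"
    and ideal: "two_sided_ideal A I"
begin

lemma two_sided_idealD:
  assumes "two_sided_ideal A J"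
  shows "J \<subseteq> alg_carrier A" "0 \<in> J" "\<lbrakk>x \<in> J; y \<in> J\<rbrakk> \<Longrightarrow> x + y \<in> J"
    "x \<in> J \<Longrightarrow> alg_smult A c x \<in> J" "x \<in> J \<Longrightarrow> - x \<in> J"
    "\<lbrakk>a \<in> alg_carrier A; x \<in> J\<rbrakk> \<Longrightarrow> alg_mult A a x \<in> J"
    "\<lbrakk>a \<in> alg_carrier A; x \<in> J\<rbrakk> \<Longrightarrow> alg_mult A x a \<in> J"
proof -
  show *: "x \<in> J \<Longrightarrow> alg_smult A c x \<in> J" "J \<subseteq> alg_carrier A" for c
    using assms by (auto simp: two_sided_ideal_def)
  show "x \<in> J \<Longrightarrow> - x \<in> J" using *(1)[of "- 1"] *(2) smult_minus_one[of x] by auto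
qed (use assms in \<open>auto simp: two_sided_ideal_def zero_eq add_eq\<close>)

lemmas I = two_sided_idealD[OF ideal]

lemma I_diff: "\<lbrakk>x \<in> I; y \<in> I\<rbrakk> \<Longrightarrow> x - y \<in> I"
  using I(3)[OF _ I(5), of x y] by simp

abbreviation cs where "cs \<equiv> alg_coset A I"

lemma mem_coset_iff: "y \<in> cs x \<longleftrightarrow> y - x \<in> I"
proof
  assume "y - x \<in> I"
  then show "y \<in> cs x" by (auto simp: alg_coset_def add_eq intro!: image_eqI[of _ _ "y - x"])
qed (auto simp: alg_coset_def add_eq)

lemma coset_eq_iff: "cs x = cs y \<longleftrightarrow> x - y \<in> I"
proof
  assume "cs x = cs y"
  then have "x \<in> cs y" using I(2) mem_coset_iff[of x x] by simp
  then show "x - y \<in> I" by (simp add: mem_coset_iff)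
next
  assume xy: "x - y \<in> I"
  have "z - x \<in> I \<longleftrightarrow> z - y \<in> I" for z
    using I(3)[OF _ xy, of "z - x"] I_diff[OF _ xy, of "z - y"] by auto
  then show "cs x = cs y" by (auto simp: mem_coset_iff)
qed

lemma coset_self: "x \<in> cs x"
  using I(2) by (simp add: mem_coset_iff)

lemma coset_carrier: "\<lbrakk>x \<in> alg_carrier A; y \<in> cs x\<rbrakk> \<Longrightarrow> y \<in> alg_carrier A"
  using I(1) carrier_add[of "y - x" x] by (auto simp: mem_coset_iff)

abbreviation Q where "Q \<equiv> quotient_algebra A I"

lemma quotient_carrier: "alg_carrier Q = cs ` alg_carrier A"
  and quotient_zero: "alg_zero Q = cs 0"
  by (simp_all add: quotient_algebra_def zero_eq)

lemma quotient_add: "alg_add Q (cs a) (cs b) = cs (a + b)"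
proof -
  have "cs (x + y) = cs (a + b)" if "x \<in> cs a" "y \<in> cs b" for x y
    using I(3)[of "x - a" "y - b"] that by (simp add: coset_eq_iff mem_coset_iff algebra_simps)
  then have "alg_add Q (cs a) (cs b) = (\<Union>x\<in>cs a. \<Union>y\<in>cs b. cs (a + b))"
    unfolding quotient_algebra_def nu_algebra.simps add_eq by (intro SUP_cong refl)
  then show ?thesis using coset_self by blast
qed

lemma quotient_smult:
  assumes a: "a \<in> alg_carrier A" shows "alg_smult Q c (cs a) = cs (alg_smult A c a)"
proof -
  have "cs (alg_smult A c x) = cs (alg_smult A c a)" if x: "x \<in> cs a" for x
  proof -
    have i: "x - a \<in> I" using x by (simp add: mem_coset_iff)
    have "alg_smult A c x = alg_smult A c (x - a) + alg_smult A c a"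
      using smult_add[of "x - a" a c] i I(1) a by auto
    then show ?thesis using I(4)[OF i, of c] by (simp add: coset_eq_iff)
  qed
  then have "alg_smult Q c (cs a) = (\<Union>x\<in>cs a. cs (alg_smult A c a))"
    unfolding quotient_algebra_def nu_algebra.simps by (intro SUP_cong refl)
  then show ?thesis using coset_self by blast
qed

lemma quotient_mult:
  assumes a: "a \<in> alg_carrier A" and b: "b \<in> alg_carrier A"
  shows "alg_mult Q (cs a) (cs b) = cs (alg_mult A a b)"
proof -
  have "cs (alg_mult A x y) = cs (alg_mult A a b)" if x: "x \<in> cs a" and y: "y \<in> cs b" for x y
  proof -
    have i: "x - a \<in> I" "y - b \<in> I" using x y by (simp_all add: mem_coset_iff)
    have "y \<in> alg_carrier A" using coset_carrier b y by blast
    moreover have "x - a \<in> alg_carrier A" "y - b \<in> alg_carrier A" using i I(1) by blast+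
    \<comment> \<open>The usual splitting xy - ab = (x - a)y + a(y - b), with both terms in the
      ideal.\<close>
    ultimately have "alg_mult A x y = alg_mult A (x - a) y + (alg_mult A a (y - b) + alg_mult A a b)"
      using mult_add_left[of "x - a" a y] mult_add_right[of a "y - b" b] a b by simp
    moreover have "alg_mult A (x - a) y + alg_mult A a (y - b) \<in> I"
      using I(3,6,7) i a \<open>y \<in> alg_carrier A\<close> by blast
    ultimately show ?thesis by (simp add: coset_eq_iff algebra_simps)
  qed
  then have "alg_mult Q (cs a) (cs b) = (\<Union>x\<in>cs a. \<Union>y\<in>cs b. cs (alg_mult A a b))"
    unfolding quotient_algebra_def nu_algebra.simps by (intro SUP_cong refl)
  then show ?thesis using coset_self by blast
qed

lemma image_ideal:
  assumes J: "two_sided_ideal A J"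
  shows "two_sided_ideal Q (cs ` J)"
proof -
  note J = two_sided_idealD[OF J]
  have "alg_add Q X Y \<in> cs ` J" if "X \<in> cs ` J" "Y \<in> cs ` J" for X Y
    using that J(3) by (auto simp: quotient_add)
  moreover have "alg_smult Q c X \<in> cs ` J" if "X \<in> cs ` J" for c X
    using that J(1,4) quotient_smult by auto
  moreover have "alg_mult Q B X \<in> cs ` J \<and> alg_mult Q X B \<in> cs ` J"
    if "B \<in> alg_carrier Q" "X \<in> cs ` J" for B X
  proof -
    obtain b x where bx: "B = cs b" "b \<in> alg_carrier A" "X = cs x" "x \<in> J"
      using \<open>B \<in> alg_carrier Q\<close> \<open>X \<in> cs ` J\<close> by (auto simp: quotient_carrier)
    moreover have "x \<in> alg_carrier A" using bx(4) J(1) by blast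
    ultimately show ?thesis using J(6,7)[of b x] by (simp add: quotient_mult)
  qed
  ultimately show ?thesis
    using J(1,2) by (auto simp: two_sided_ideal_def quotient_carrier quotient_zero)
qed

lemma vimage_ideal:
  assumes J: "two_sided_ideal Q J"
  shows "two_sided_ideal A {x \<in> alg_carrier A. cs x \<in> J}" "I \<subseteq> {x \<in> alg_carrier A. cs x \<in> J}"
proof -
  have J0: "cs 0 \<in> J"
    and J1: "\<And>X Y. X \<in> J \<Longrightarrow> Y \<in> J \<Longrightarrow> alg_add Q X Y \<in> J"
    and J2: "\<And>c X. X \<in> J \<Longrightarrow> alg_smult Q c X \<in> J"
    and J3: "\<And>b X. b \<in> alg_carrier A \<Longrightarrow> X \<in> J \<Longrightarrow> alg_mult Q (cs b) X \<in> J \<and> alg_mult Q X (cs b) \<in> J"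
    using J by (auto simp: two_sided_ideal_def quotient_carrier quotient_zero)
  have "cs (x + y) \<in> J" if "cs x \<in> J" "cs y \<in> J" for x y
    using J1[OF that] by (simp add: quotient_add)
  moreover have "cs (alg_smult A c x) \<in> J" if "x \<in> alg_carrier A" "cs x \<in> J" for x c
    using J2[OF that(2), of c] that(1) by (simp add: quotient_smult)
  moreover have "cs (alg_mult A b x) \<in> J \<and> cs (alg_mult A x b) \<in> J"
    if "b \<in> alg_carrier A" "x \<in> alg_carrier A" "cs x \<in> J" for b x
    using J3[OF that(1,3)] that(1,2) by (simp add: quotient_mult)
  ultimately show "two_sided_ideal A {x \<in> alg_carrier A. cs x \<in> J}"
    using J0 I(1,2) carrier_add carrier_smult carrier_mult
    by (auto simp: two_sided_ideal_def zero_eq add_eq)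
  have "cs x \<in> J" if "x \<in> I" for x using that J0 coset_eq_iff[of x 0] by simp
  then show "I \<subseteq> {x \<in> alg_carrier A. cs x \<in> J}" using I(1) by blast
qed

text \<open>Images and preimages under the coset map relate the ideals of the quotient to the ideals
  of \<open>A\<close> that contain \<open>I\<close>.\<close>

lemma simple_quotient_iff:
  "simple_algebra Q \<longleftrightarrow> I \<noteq> alg_carrier A \<and>
    (\<forall>J. two_sided_ideal A J \<and> I \<subseteq> J \<longrightarrow> J = I \<or> J = alg_carrier A)"
proof
  assume s: "simple_algebra Q"
  have "I \<noteq> alg_carrier A"
  proof
    assume "I = alg_carrier A"
    then have "cs x = cs 0" if "x \<in> alg_carrier A" for x
      unfolding coset_eq_iff using that by simp
    then have "alg_carrier Q = {alg_zero Q}"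
      using I(1,2) unfolding quotient_carrier quotient_zero by blast
    with s show False by (simp add: simple_algebra_def)
  qed
  moreover have "J = I \<or> J = alg_carrier A" if J: "two_sided_ideal A J" "I \<subseteq> J" for J
  proof -
    note JD = two_sided_idealD[OF J(1)]
    have "cs ` J = {alg_zero Q} \<or> cs ` J = alg_carrier Q"
      using s image_ideal[OF J(1)] unfolding simple_algebra_def by blast
    then show ?thesis
    proof
      assume 0: "cs ` J = {alg_zero Q}"
      have "x \<in> I" if "x \<in> J" for x
      proof -
        have "cs x = cs 0" using 0 that unfolding quotient_zero by blast
        then show ?thesis by (simp add: coset_eq_iff)
      qed
      with J(2) show ?thesis by blast
    next
      assume 1: "cs ` J = alg_carrier Q"
      \<comment> \<open>Elements with equal cosets differ by an element of \<open>I\<close>, which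
        is contained in \<open>J\<close>; so \<open>J\<close> is determined by its image.\<close>
      have "x \<in> J" if "x \<in> alg_carrier A" for x
      proof -
        have "cs x \<in> cs ` J" using 1 that unfolding quotient_carrier by blast
        then obtain y where y: "y \<in> J" "cs x = cs y" by blast
        then have "x - y \<in> J" using J(2) coset_eq_iff by blast
        then show ?thesis using JD(3)[OF _ y(1)] by force
      qed
      with JD(1) show ?thesis by blast
    qed
  qed
  ultimately show "I \<noteq> alg_carrier A \<and>
    (\<forall>J. two_sided_ideal A J \<and> I \<subseteq> J \<longrightarrow> J = I \<or> J = alg_carrier A)" by blast
next
  assume *: "I \<noteq> alg_carrier A \<and>
    (\<forall>J. two_sided_ideal A J \<and> I \<subseteq> J \<longrightarrow> J = I \<or> J = alg_carrier A)"
  then obtain x where x: "x \<in> alg_carrier A" "x \<notin> I" using I(1) by blast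
  then have "cs x \<noteq> cs 0" by (simp add: coset_eq_iff)
  then have "alg_carrier Q \<noteq> {alg_zero Q}" using x unfolding quotient_carrier quotient_zero by blast
  moreover have "J = {alg_zero Q} \<or> J = alg_carrier Q" if J: "two_sided_ideal Q J" for J
  proof -
    let ?J = "{x \<in> alg_carrier A. cs x \<in> J}"
    have JQ: "J = cs ` ?J" "cs 0 \<in> J"
      using J by (auto simp: two_sided_ideal_def quotient_carrier quotient_zero)
    have "?J = I \<or> ?J = alg_carrier A" using * vimage_ideal[OF J] by blast
    then show ?thesis
    proof
      assume "?J = I"
      moreover have "cs x = cs 0" if "x \<in> I" for x using that by (simp add: coset_eq_iff)
      ultimately have "J = {cs 0}" using JQ I(2) by blast
      then show ?thesis by (simp add: quotient_zero)
    next
      assume "?J = alg_carrier A"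
      with JQ show ?thesis by (simp add: quotient_carrier)
    qed
  qed
  ultimately show "simple_algebra Q" by (simp add: simple_algebra_def)
qed

end

section \<open>Ideals of the essential algebra\<close>

context ample_groupoid
begin

lemma algebra_ideal_singular:
  "algebra_ideal (steinberg_algebra G :: ('k::comm_ring_1, 'a \<Rightarrow> 'k) nu_algebra) (singular_functions G)"
proof
  show "two_sided_ideal (steinberg_algebra G) (singular_functions G :: ('a \<Rightarrow> 'k) set)"
    by (rule two_sided_ideal_singular)
qed (auto simp: steinberg_algebra_def steinberg_add steinberg_scale steinberg_convolution
    convolution_add_left convolution_add_right simp del: plus_fun_apply,
    auto simp: fun_scale_def fun_eq_iff distrib_left)

lemma simple_essential_algebra_iff:
  "simple_algebra (essential_algebra G :: ('k::comm_ring_1, ('a \<Rightarrow> 'k) set) nu_algebra) \<longleftrightarrow>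
    (singular_functions G :: ('a \<Rightarrow> 'k) set) \<noteq> steinberg_functions G \<and>
    (\<forall>J :: ('a \<Rightarrow> 'k) set. two_sided_ideal (steinberg_algebra G) J \<and> singular_functions G \<subseteq> J \<longrightarrow>
      J = singular_functions G \<or> J = steinberg_functions G)"
  using algebra_ideal.simple_quotient_iff[OF algebra_ideal_singular]
  by (simp add: essential_algebra_def) (simp add: steinberg_algebra_def)

lemma indicator_not_singular:
  assumes "U \<in> bisections" "U \<noteq> {}"
  shows "(indicator U :: 'a \<Rightarrow> 'k::comm_ring_1) \<notin> singular_functions G"
  using singularD(2)[of "indicator U :: 'a \<Rightarrow> 'k" U] assms bisectionsD(1) by auto

text \<open>The indicator of a compact open set of units around \<open>x\<close> has diagonal
  coefficient 1 at \<open>x\<close>.\<close>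

lemma fibre_sum_kernel_neq_steinberg:
  assumes "x \<in> S" "x \<in> units G"
  shows "(fibre_sum_kernel S :: ('a \<Rightarrow> 'k::comm_ring_1) set) \<noteq> steinberg_functions G"
proof -
  obtain V where V: "V \<in> bisections" "V \<subseteq> units G" "x \<in> V"
    using compact_open_unit_nbhd[OF open_units] assms(2) by metis
  have "fibre_sum (indicator V) x x = (1 :: 'k)"
    using assms(2) bexI[OF _ V(3), of "\<lambda>g. r g = x \<and> d g = x"] by (simp add: fibre_sum_indicator[OF V(1)])
  then have "(indicator V :: 'a \<Rightarrow> 'k) \<notin> fibre_sum_kernel S"
    using assms(1) zero_neq_one unfolding fibre_sum_kernel_def by force
  with steinberg_indicator[OF V(1)] show ?thesis by metis
qed

section \<open>Simplicity of the essential algebra\<close>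

text \<open>The kernel is an ideal that contains the singular functions, and it is proper since
  \<open>S\<close> contains a unit; simplicity leaves one possibility.\<close>

lemma simple_imp_fibre_sum_kernel_eq:
  assumes "simple_algebra (essential_algebra G :: ('k::comm_ring_1, ('a \<Rightarrow> 'k) set) nu_algebra)"
    and "\<And>g. g \<in> arrows G \<Longrightarrow> d g \<in> S \<longleftrightarrow> r g \<in> S" "x \<in> S" "x \<in> units G"
  shows "(fibre_sum_kernel S :: ('a \<Rightarrow> 'k) set) = singular_functions G"
  using assms(1) two_sided_ideal_fibre_sum_kernel[OF assms(2)] singular_subset_fibre_sum_kernel
    fibre_sum_kernel_neq_steinberg[OF assms(3,4)]
  unfolding simple_essential_algebra_iff by blast

lemma simple_imp_minimal:
  assumes s: "simple_algebra (essential_algebra G :: ('k::comm_ring_1, ('a \<Rightarrow> 'k) set) nu_algebra)"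
  shows "minimal_groupoid G"
  unfolding minimal_groupoid_def closure_of_eq_topspace
proof (intro ballI)
  fix x assume x: "x \<in> units G"
  have ker: "(fibre_sum_kernel (orbit G x) :: ('a \<Rightarrow> 'k) set) = singular_functions G"
    by (rule simple_imp_fibre_sum_kernel_eq[OF s orbit_invariant mem_orbit_self[OF x] x])
  show "unit_top G interior_of (topspace (unit_top G) - orbit G x) = {}"
    unfolding interior_of_eq_empty
  proof (intro allI impI, rule ccontr)
    fix T assume T: "openin (unit_top G) T \<and> T \<subseteq> topspace (unit_top G) - orbit G x" "T \<noteq> {}"
    then obtain y where "y \<in> T" "y \<in> units G" "openin X T" by (auto simp: openin_unit_top_iff)
    then obtain V where V: "V \<in> bisections" "V \<subseteq> units G" "y \<in> V" "V \<subseteq> T"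
      using compact_open_unit_nbhd by metis
    have "fibre_sum (indicator V) y' z = (0 :: 'k)" if "y' \<in> orbit G x" for y' z
    proof -
      \<comment> \<open>An arrow of \<open>V\<close> is a unit and equals its range, so it would be
        a point of the orbit inside \<open>T\<close>.\<close>
      have "\<not> (\<exists>g\<in>V. r g = y' \<and> d g = z)" using V(2,4) T(1) that by (auto simp: subset_iff)
      then show ?thesis by (simp add: fibre_sum_indicator[OF V(1)])
    qed
    then have "(indicator V :: 'a \<Rightarrow> 'k) \<in> fibre_sum_kernel (orbit G x)"
      using steinberg_indicator[OF V(1)] by (simp add: fibre_sum_kernel_def)
    then show False using indicator_not_singular[OF V(1)] V(3) unfolding ker by blast
  qed
qed

lemma simple_imp_topologically_free:
  assumes s: "simple_algebra (essential_algebra G :: ('k::comm_ring_1, ('a \<Rightarrow> 'k) set) nu_algebra)"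
  shows "topologically_free G"
  unfolding topologically_free_def interior_of_eq_empty
proof (intro allI impI, rule ccontr)
  fix T assume T: "openin X T \<and> T \<subseteq> isotropy G - units G" "T \<noteq> {}"
  then obtain g where g: "g \<in> T" by blast
  then obtain U where U: "U \<in> bisections" "g \<in> U" "U \<subseteq> T" using bisection_nbhd T(1) by metis
  note dU = bisection_dom[OF U(1)]
  have "g \<in> arrows G" using U mem_bisection_arrow by blast
  then have ker: "(fibre_sum_kernel (units G) :: ('a \<Rightarrow> 'k) set) = singular_functions G"
    by (intro simple_imp_fibre_sum_kernel_eq[OF s, of _ "d g"]) auto
  define f :: "'a \<Rightarrow> 'k" where "f = indicator U + fun_scale (- 1) (indicator (d ` U))"
  have "fibre_sum f y z = 0" for y z
  proof -
    \<comment> \<open>Since \<open>g\<close> in \<open>U\<close> is an isotropy arrow,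
      \<open>g\<close> and \<open>d g\<close> have the same domain and range, so the two indicators
      have equal fibre sums.\<close>
    have "(\<exists>g\<in>U. r g = y \<and> d g = z) \<longleftrightarrow> (\<exists>x\<in>d ` U. r x = y \<and> d x = z)"
    proof -
      have "r (d g) = r g" "d (d g) = d g" if "g \<in> U" for g
        using that U T(1) mem_bisection_arrow[OF U(1) that] by (auto simp: isotropy_def)
      then show ?thesis by simp
    qed
    then show ?thesis
      unfolding f_def using U(1) dU
      by (simp add: fibre_sum_add fibre_sum_scale fibre_sum_indicator steinberg_indicator steinberg_scale
          del: fun_module.scale_minus_left)
  qed
  then have "f \<in> fibre_sum_kernel (units G)"
    using U(1) dU by (simp add: fibre_sum_kernel_def f_def steinberg_diff steinberg_indicator)
  then have "f \<in> singular_functions G" by (simp only: ker)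
  moreover have "f h \<noteq> 0" if "h \<in> U" for h
  proof -
    \<comment> \<open>\<open>U\<close> contains no unit, so the second indicator vanishes on
      \<open>U\<close> and \<open>f\<close> is 1 there.\<close>
    have "h \<notin> d ` U" using that U(3) T(1) dU(2) by blast
    then show ?thesis using that by (simp add: f_def fun_scale_def)
  qed
  ultimately show False using singularD(2)[of f U] bisectionsD(1)[OF U(1)] U(2) by blast
qed

text \<open>The bisections are treated one at a time. If some arrow of \<open>U\<close> starts in
  the current set, topological freeness provides such an arrow \<open>g\<close> that is a unit, or
  has \<open>d g\<close> and \<open>r g\<close> distinct. In the first case \<open>U\<close> meets
  the set in an open set of units; in the second, disjoint neighbourhoods of \<open>d g\<close> and
  \<open>r g\<close> are used.\<close>

lemma topologically_free_separation:
  assumes tf: "topologically_free G" and F: "finite F" "F \<subseteq> bisections"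
    and N: "openin X N" "N \<noteq> {}" "N \<subseteq> units G"
  shows "\<exists>N'. openin X N' \<and> N' \<noteq> {} \<and> N' \<subseteq> N \<and>
    (\<forall>U\<in>F. N' \<subseteq> U \<or> (\<forall>g\<in>U. \<not> (d g \<in> N' \<and> r g \<in> N')))"
  using F
proof (induction F)
  case empty
  then show ?case using N by auto
next
  case (insert U F)
  then obtain N1 where N1: "openin X N1" "N1 \<noteq> {}" "N1 \<subseteq> N"
    "\<forall>U\<in>F. N1 \<subseteq> U \<or> (\<forall>g\<in>U. \<not> (d g \<in> N1 \<and> r g \<in> N1))" by auto
  have U: "U \<in> bisections" using insert.prems by simp
  \<comment> \<open>Both alternatives pass to subsets, so shrinking preserves what was achieved for
    the earlier bisections.\<close>
  have shrink: ?case if N2: "openin X N2" "N2 \<noteq> {}" "N2 \<subseteq> N1"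
    "N2 \<subseteq> U \<or> (\<forall>g\<in>U. \<not> (d g \<in> N2 \<and> r g \<in> N2))" for N2
  proof -
    have "\<forall>V\<in>insert U F. N2 \<subseteq> V \<or> (\<forall>g\<in>V. \<not> (d g \<in> N2 \<and> r g \<in> N2))"
      using N2(3,4) N1(4) by blast
    then show ?thesis using N2 N1(3) by (intro exI[of _ N2]) blast
  qed
  let ?W = "{g \<in> arrows G. d g \<in> N1} \<inter> U"
  have W: "openin X ?W" using N1(1) bisectionsD(1)[OF U] openin_dom_vimage by blast
  show ?case
  proof (cases "?W = {}")
    case True
    then have "\<forall>g\<in>U. \<not> (d g \<in> N1 \<and> r g \<in> N1)" using mem_bisection_arrow[OF U] by blast
    then show ?thesis using shrink N1 by blast
  next
    case False
    then obtain g where g: "g \<in> ?W" "g \<in> units G \<or> d g \<noteq> r g"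
      using tf W unfolding topologically_free_def interior_of_eq_empty isotropy_def by blast
    show ?thesis
    proof (cases "g \<in> units G")
      case True
      then have "g \<in> U \<inter> N1" using g(1) dom_of_unit by auto
      then show ?thesis
        using N1(1) bisectionsD(1)[OF U] by (intro shrink[of "U \<inter> N1"]) auto
    next
      case False
      then have "d g \<noteq> r g" "g \<in> arrows G" using g by auto
      then obtain A B where AB: "openin (unit_top G) A" "openin (unit_top G) B" "d g \<in> A" "r g \<in> B" "disjnt A B"
        using units_Hausdorff unfolding Hausdorff_space_def topspace_unit_top
        by (metis dom_in_units rng_unit)
      let ?W' = "?W \<inter> {g \<in> arrows G. r g \<in> B}"
      have W': "openin X ?W'" "g \<in> ?W'"
        using W AB g(1) \<open>g \<in> arrows G\<close> by (auto simp: openin_unit_top_iff intro: openin_rng_vimage)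
      \<comment> \<open>By injectivity of \<open>d\<close> on \<open>U\<close>, an arrow of
        \<open>U\<close> with domain in the image of \<open>?W'\<close> lies in \<open>?W'\<close>;
        its range is then in \<open>B\<close>, which is disjoint from \<open>A\<close>.\<close>
      have "\<not> (d h \<in> A \<inter> d ` ?W' \<and> r h \<in> A \<inter> d ` ?W')" if h: "h \<in> U" for h
      proof
        assume *: "d h \<in> A \<inter> d ` ?W' \<and> r h \<in> A \<inter> d ` ?W'"
        then obtain k where k: "k \<in> ?W'" "d h = d k" by blast
        then have "h = k" using inj_onD[OF bisectionsD(2)[OF U]] h by blast
        then show False using k(1) * AB(5) by (auto simp: disjnt_iff)
      qed
      moreover have "openin X (A \<inter> d ` ?W')"
        using AB(1) open_dom[OF W'(1)] by (simp add: openin_unit_top_iff openin_Int)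
      moreover have "d g \<in> A \<inter> d ` ?W'" using AB(3) W'(2) by blast
      moreover have "A \<inter> d ` ?W' \<subseteq> N1" by blast
      ultimately show ?thesis by (intro shrink[of "A \<inter> d ` ?W'"]) blast+
    qed
  qed
qed

end

section \<open>Ideals containing a nonsingular function\<close>

context ample_groupoid
begin

lemma steinberg_idealD:
  assumes "two_sided_ideal (steinberg_algebra G) J"
  shows "J \<subseteq> steinberg_functions G" "0 \<in> J" "\<lbrakk>x \<in> J; y \<in> J\<rbrakk> \<Longrightarrow> x + y \<in> J"
    "x \<in> J \<Longrightarrow> fun_scale c x \<in> J"
    "\<lbrakk>U \<in> bisections; x \<in> J\<rbrakk> \<Longrightarrow> convolution G (indicator U) x \<in> J"
    "\<lbrakk>U \<in> bisections; x \<in> J\<rbrakk> \<Longrightarrow> convolution G x (indicator U) \<in> J"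
  using assms by (auto simp: two_sided_ideal_def steinberg_algebra_def steinberg_indicator)

text \<open>Applying \<open>flip\<close> twice exchanges the factors, which makes the pointwise
  formulas for left multiplication available on the right.\<close>

lemma convolution_indicator_right:
  assumes "f \<in> steinberg_functions G" "U \<in> bisections"
  shows "convolution G f (indicator U) = flip (convolution G (indicator (iv ` U)) (flip f))"
proof -
  have "convolution G f (indicator U) = flip (flip (convolution G f (indicator U)))"
    using assms by (simp add: flip_flip_steinberg steinberg_convolution steinberg_indicator)
  then show ?thesis
    by (simp add: flip_convolution[of f] flip_indicator[OF bisectionsD(5)[OF assms(2)]])
qed

lemma inv_image_units:
  assumes "V \<subseteq> units G" shows "iv ` V = V"
proof -
  have "iv x = x" if "x \<in> V" for x using that assms by auto
  then show ?thesis by simp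
qed

lemma convolution_indicator_units_right:
  assumes "f \<in> steinberg_functions G" "V \<in> bisections" "V \<subseteq> units G" "g \<in> arrows G"
  shows "convolution G f (indicator V) g = (if d g \<in> V then f g else 0)"
  using assms convolution_indicator_units_left[OF assms(2,3), of "iv g" "flip f"]
  by (simp add: convolution_indicator_right inv_image_units flip_def)

lemma ideal_contains_unit_indicator:
  fixes J :: "('a \<Rightarrow> 'k::field) set"
  assumes tf: "topologically_free G" and J: "two_sided_ideal (steinberg_algebra G) J"
    and f: "f \<in> J" "f \<notin> singular_functions G"
  obtains V where "V \<in> bisections" "V \<subseteq> units G" "V \<noteq> {}" "indicator V \<in> J"
proof -
  note JD = steinberg_idealD[OF J]
  have fs: "f \<in> steinberg_functions G" using f(1) JD(1) by blast
  then have "gtop G interior_of {g \<in> arrows G. f g \<noteq> 0} \<noteq> {}"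
    using f(2) by (simp add: singular_functions_def)
  then obtain W g where W: "openin X W" "W \<subseteq> {g \<in> arrows G. f g \<noteq> 0}" "g \<in> W"
    unfolding interior_of_eq_empty by blast
  then obtain U where U: "U \<in> bisections" "g \<in> U" "U \<subseteq> W" using bisection_nbhd by metis
  \<comment> \<open>Right multiplication by the inverse bisection carries the value of
    \<open>f\<close> at an arrow \<open>a\<close> of \<open>U\<close> to the unit
    \<open>r a\<close>.\<close>
  define f' where "f' = convolution G f (indicator (iv ` U))"
  have f'J: "f' \<in> J" unfolding f'_def by (rule JD(6)[OF bisection_inv[OF U(1)] f(1)])
  then have f's: "f' \<in> steinberg_functions G" using JD(1) by blast
  have f'0: "f' (r a) \<noteq> 0" if a: "a \<in> U" for a
  proof -
    have arr: "a \<in> arrows G" using mem_bisection_arrow[OF U(1) a] .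
    have "f' = flip (convolution G (indicator U) (flip f))"
      unfolding f'_def convolution_indicator_right[OF fs bisection_inv[OF U(1)]]
      using inv_image_inv_image[OF bisectionsD(5)[OF U(1)]] by simp
    then have "f' (r a) = convolution G (indicator U) (flip f) (r a)"
      using arr by (simp add: flip_def)
    also have "\<dots> = flip f (iv a \<cdot> r a)"
      using arr by (intro convolution_indicator_left[OF U(1) a]) auto
    also have "\<dots> = f a" using arr by (simp add: flip_def)
    finally show ?thesis using a U(3) W(2) by auto
  qed
  obtain F where F: "finite F" "F \<subseteq> bisections"
    "\<And>g h. (\<forall>U\<in>F. g \<in> U \<longleftrightarrow> h \<in> U) \<Longrightarrow> f' g = f' h" "\<And>g. f' g \<noteq> 0 \<Longrightarrow> \<exists>U\<in>F. g \<in> U"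
    using steinberg_explicit[OF f's] by metis
  have rU: "openin X (r ` U)" "r ` U \<noteq> {}" "r ` U \<subseteq> units G"
    using bisection_rng[OF U(1)] bisectionsD(1) U(2) by auto
  obtain N where N: "openin X N" "N \<noteq> {}" "N \<subseteq> r ` U"
    "\<forall>U\<in>F. N \<subseteq> U \<or> (\<forall>g\<in>U. \<not> (d g \<in> N \<and> r g \<in> N))"
    using topologically_free_separation[OF tf F(1,2) rU] by (elim exE conjE)
  then obtain x where x: "x \<in> N" "x \<in> units G" "f' x \<noteq> 0" using f'0 rU(3) by blast
  obtain V where V: "V \<in> bisections" "V \<subseteq> units G" "x \<in> V" "V \<subseteq> N"
    using compact_open_unit_nbhd[OF N(1) x(1,2)] by metis
  \<comment> \<open>This keeps the values of \<open>f'\<close> at the arrows with both ends in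
    \<open>V\<close> and is zero elsewhere.\<close>
  define h where "h = convolution G (convolution G (indicator V) f') (indicator V)"
  have cs: "convolution G (indicator V) f' \<in> steinberg_functions G"
    using JD(1,5) V(1) f'J by blast
  have "h k = fun_scale (f' x) (indicator V) k" for k
  proof (cases "k \<in> arrows G \<and> d k \<in> V \<and> r k \<in> V")
    case True
    then have hk: "h k = f' k"
      using V by (simp add: h_def convolution_indicator_units_right[OF cs] convolution_indicator_units_left)
    show ?thesis
    proof (cases "k \<in> units G")
      case unit: True
      then have "k \<in> V" using True by simp
      \<comment> \<open>A unit in \<open>N\<close> is an arrow from \<open>N\<close> to
        \<open>N\<close>, so each member of \<open>F\<close> contains all of \<open>N\<close> or no
        point of it; \<open>f'\<close> cannot tell \<open>k\<close> from \<open>x\<close>.\<close>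
      moreover have "f' k = f' x"
      proof (rule F(3), intro ballI)
        fix U assume "U \<in> F"
        then have "N \<subseteq> U \<or> (\<forall>g\<in>U. \<not> (d g \<in> N \<and> r g \<in> N))" using N(4) by blast
        moreover have "k \<in> N" "d k \<in> N" "r k \<in> N" "d x \<in> N" "r x \<in> N"
          using \<open>k \<in> V\<close> V(4) unit x by auto
        ultimately show "k \<in> U \<longleftrightarrow> x \<in> U" using x(1) by blast
      qed
      ultimately show ?thesis using hk by (simp add: fun_scale_def)
    next
      case nonunit: False
      \<comment> \<open>A member of \<open>F\<close> containing \<open>k\<close> has an arrow from
        \<open>N\<close> to \<open>N\<close>, so it contains \<open>N\<close> and in particular
        \<open>d k\<close>. Injectivity of \<open>d\<close> on it would make \<open>k\<close> a
        unit.\<close>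
      have "f' k = 0"
      proof (rule ccontr)
        assume "f' k \<noteq> 0"
        then obtain U where U: "U \<in> F" "k \<in> U" using F(4) by blast
        then have "N \<subseteq> U" using N(4) True V(4) by blast
        then have "d k \<in> U" using True V(4) by blast
        moreover have "inj_on d U" using U(1) F(2) bisectionsD(2) by blast
        ultimately have "d k = k" using inj_onD[of d U "d k" k] U(2) True by simp
        then show False using nonunit True dom_in_units[of k] by simp
      qed
      then show ?thesis using hk nonunit V(2) by (auto simp: fun_scale_def indicator_def)
    qed
  next
    case False
    then have "k \<notin> V" using V(2) by (auto simp: subset_iff)
    moreover have "h k = 0"
    proof (cases "k \<in> arrows G")
      case True
      then show ?thesis
        using False V by (auto simp: h_def convolution_indicator_units_right[OF cs] convolution_indicator_units_left)
    qed (simp add: h_def)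
    ultimately show ?thesis by (simp add: fun_scale_def)
  qed
  \<comment> \<open>The coefficients form a field, so the nonzero value \<open>f' x\<close> can be
    inverted.\<close>
  then have "indicator V = fun_scale (inverse (f' x)) h"
    using x(3) by (auto simp: fun_scale_def fun_eq_iff)
  moreover have "h \<in> J" unfolding h_def using JD(5,6) V(1) f'J by blast
  ultimately have "indicator V \<in> J" using JD(4) by metis
  then show thesis using that V by blast
qed

lemma setmul_units_left: "A \<subseteq> units G \<Longrightarrow> B \<subseteq> arrows G \<Longrightarrow> setmul A B = {b \<in> B. r b \<in> A}"
proof (intro set_eqI iffI)
  fix g assume AB: "A \<subseteq> units G" "B \<subseteq> arrows G" and "g \<in> {b \<in> B. r b \<in> A}"
  then show "g \<in> setmul A B" using setmulI[of "r g" A g B] by auto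
qed (auto simp: setmul_def subset_iff)

lemma setmul_dom_image: "B \<subseteq> arrows G \<Longrightarrow> setmul B (d ` B) = B"
proof (intro set_eqI iffI)
  fix g assume B: "B \<subseteq> arrows G"
  show "g \<in> B" if g: "g \<in> setmul B (d ` B)"
  proof -
    obtain a b where "a \<in> B" "b \<in> B" "g = a \<cdot> d b" "d a = r (d b)"
      using g unfolding setmul_def by blast
    moreover have "a \<in> arrows G" "b \<in> arrows G" using calculation B by auto
    ultimately show ?thesis by simp
  qed
  show "g \<in> setmul B (d ` B)" if "g \<in> B"
    using setmulI[of g B "d g" "d ` B"] that B by auto
qed

text \<open>Injectivity of \<open>r\<close> on \<open>U\<close> allows only products of an arrow of
  \<open>U\<close> with its own inverse.\<close>

lemma setmul_inv_self:
  assumes U: "U \<in> bisections"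
  shows "setmul (iv ` U) U = d ` U"
proof (intro set_eqI iffI)
  fix g assume "g \<in> setmul (iv ` U) U"
  then obtain a b where ab: "a \<in> U" "b \<in> U" "g = iv a \<cdot> b" "d (iv a) = r b" by (auto simp: setmul_def)
  then have "r a = r b" using mem_bisection_arrow[OF U] by simp
  then have "a = b" using inj_onD[OF bisectionsD(3)[OF U]] ab by blast
  then show "g \<in> d ` U" using ab mem_bisection_arrow[OF U] by simp
next
  fix g assume "g \<in> d ` U"
  then obtain a where "a \<in> U" "g = d a" by blast
  then show "g \<in> setmul (iv ` U) U"
    using mem_bisection_arrow[OF U] setmulI[of "iv a" "iv ` U" a U] by simp
qed

lemma minimal_ideal_eq:
  assumes min: "minimal_groupoid G" and J: "two_sided_ideal (steinberg_algebra G) J"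
    and V: "V \<in> bisections" "V \<subseteq> units G" "V \<noteq> {}" "indicator V \<in> (J :: ('a \<Rightarrow> 'k::comm_ring_1) set)"
  shows "J = steinberg_functions G"
proof -
  note JD = steinberg_idealD[OF J]
  have conv: "indicator (setmul A B) \<in> J"
    if "A \<in> bisections" "B \<in> bisections" "indicator A \<in> J \<or> indicator B \<in> J" for A B
    using that JD(5)[of A "indicator B"] JD(6)[of B "indicator A"]
    by (auto simp: convolution_indicator_indicator)
  \<comment> \<open>These sets cover the units and are closed under finite unions, so by compactness
    a single one contains d(U) for any given bisection \<open>U\<close>.\<close>
  define \<A> where "\<A> = {A \<in> bisections. A \<subseteq> units G \<and> indicator A \<in> J}"
  have cover: "\<exists>A\<in>\<A>. x \<in> A" if x: "x \<in> units G" for x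
  proof -
    have "unit_top G interior_of (units G - orbit G x) = {}"
      using min x unfolding minimal_groupoid_def closure_of_eq_topspace by simp
    moreover have "openin (unit_top G) V" using V bisectionsD(1) by (simp add: openin_unit_top_iff)
    ultimately have "\<not> V \<subseteq> units G - orbit G x"
      using V(3) unfolding interior_of_eq_empty by blast
    \<comment> \<open>Density of the orbit gives an arrow from \<open>x\<close> into
      \<open>V\<close>. A bisection \<open>U\<close> around it with ranges in \<open>V\<close>
      satisfies VU = U, and U^-1 U = d(U) contains \<open>x\<close>.\<close>
    then obtain g where g: "g \<in> arrows G" "d g = x" "r g \<in> V" using V(2) by (auto simp: orbit_def)
    then obtain U where U: "U \<in> bisections" "g \<in> U" "U \<subseteq> {g \<in> arrows G. r g \<in> V}"
      using bisection_nbhd[OF openin_rng_vimage[OF bisectionsD(1)[OF V(1)]], of g] by blast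
    have "setmul V U = U" using setmul_units_left[OF V(2) bisectionsD(5)[OF U(1)]] U(3) by blast
    then have "indicator U \<in> J" using conv[OF V(1) U(1)] V(4) by simp
    then have "indicator (d ` U) \<in> J"
      using conv[OF bisection_inv[OF U(1)] U(1)] setmul_inv_self[OF U(1)] by simp
    then show ?thesis using bisection_dom[OF U(1)] U(2) g(2) unfolding \<A>_def by blast
  qed
  have un: "A \<union> B \<in> \<A>" if "A \<in> \<A>" "B \<in> \<A>" for A B
  proof -
    have AB: "A \<in> bisections" "B \<in> bisections" "A \<subseteq> units G" "B \<subseteq> units G" "indicator A \<in> J" "indicator B \<in> J"
      using that by (auto simp: \<A>_def)
    have "setmul A B = A \<inter> B"
      using setmul_units_left[OF AB(3) bisectionsD(5)[OF AB(2)]] AB(4) by force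
    then have "indicator (A \<inter> B) \<in> J" using conv[OF AB(1,2)] AB(5) by simp
    \<comment> \<open>Inclusion-exclusion; for sets of units the intersection is the product, so its
      indicator is in \<open>J\<close>.\<close>
    then have "(indicator A + indicator B) + fun_scale (- 1) (indicator (A \<inter> B)) \<in> J"
      using AB JD(3,4) by blast
    moreover have "(indicator A + indicator B) + fun_scale (- 1) (indicator (A \<inter> B)) =
        (indicator (A \<union> B) :: 'a \<Rightarrow> 'k)"
      by (auto simp: fun_eq_iff fun_scale_def indicator_def)
    moreover have "A \<union> B \<in> bisections"
      using AB bisectionsD(1,4) by (intro bisection_units openin_Un compactin_Un) auto
    ultimately show ?thesis using AB by (simp add: \<A>_def)
  qed
  have empty: "{} \<in> \<A>"
  proof -
    have "indicator {} = (0 :: 'a \<Rightarrow> 'k)" by (simp add: fun_eq_iff)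
    then show ?thesis using JD(2) bisection_units[of "{}"] by (simp add: \<A>_def)
  qed
  have Union: "\<Union>\<F> \<in> \<A>" if "finite \<F>" "\<F> \<subseteq> \<A>" for \<F>
    using that by (induction \<F>) (use empty un in auto)
  have ind: "indicator U \<in> J" if U: "U \<in> bisections" for U
  proof -
    note dU = bisection_dom[OF U]
    have "d ` U \<subseteq> \<Union>\<A>" using cover dU(2) by blast
    moreover have "\<forall>A\<in>\<A>. openin X A" using bisectionsD(1) by (auto simp: \<A>_def)
    ultimately obtain \<F> where \<F>: "finite \<F>" "\<F> \<subseteq> \<A>" "d ` U \<subseteq> \<Union>\<F>"
      using bisectionsD(4)[OF dU(1)] unfolding compactin_def by metis
    have A: "\<Union>\<F> \<in> bisections" "\<Union>\<F> \<subseteq> units G" "indicator (\<Union>\<F>) \<in> J"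
      using Union[OF \<F>(1,2)] by (auto simp: \<A>_def)
    have "r x \<in> \<Union>\<F>" if x: "x \<in> d ` U" for x
      using rng_of_unit[OF subsetD[OF dU(2) x]] subsetD[OF \<F>(3) x] by simp
    then have "{b \<in> d ` U. r b \<in> \<Union>\<F>} = d ` U" by blast
    moreover have "setmul (\<Union>\<F>) (d ` U) = {b \<in> d ` U. r b \<in> \<Union>\<F>}"
      by (rule setmul_units_left[OF A(2) bisectionsD(5)[OF dU(1)]])
    \<comment> \<open>The set d(U) equals its product with the larger set of units, and
      \<open>U\<close> equals its product with d(U); both indicators are thus multiples of elements
      of \<open>J\<close>.\<close>
    ultimately have "indicator (d ` U) \<in> J" using conv[OF A(1) dU(1)] A(3) by simp
    then show ?thesis using conv[OF U dU(1)] setmul_dom_image[OF bisectionsD(5)[OF U]] by simp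
  qed
  have "f \<in> J" if "f \<in> steinberg_functions G" for f
    using that
  proof (induction rule: steinberg_induct)
    case (step U c f)
    then have "fun_scale c (indicator U) + f \<in> J" using ind JD(3,4) by blast
    then show ?case .
  qed (rule JD(2))
  with JD(1) show ?thesis by blast
qed

lemma simple_if_minimal_topologically_free:
  assumes "arrows G \<noteq> {}" "minimal_groupoid G" "topologically_free G"
  shows "simple_algebra (essential_algebra G :: ('k::field, ('a \<Rightarrow> 'k) set) nu_algebra)"
  unfolding simple_essential_algebra_iff
proof (intro conjI allI impI)
  obtain x where "x \<in> units G" using assms(1) dom_in_units by blast
  then obtain V where "V \<in> bisections" "x \<in> V" using compact_open_unit_nbhd[OF open_units] by metis
  then show "(singular_functions G :: ('a \<Rightarrow> 'k) set) \<noteq> steinberg_functions G"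
    using indicator_not_singular[of V] steinberg_indicator[of V] by blast
next
  fix J :: "('a \<Rightarrow> 'k) set"
  assume J: "two_sided_ideal (steinberg_algebra G) J \<and> singular_functions G \<subseteq> J"
  show "J = singular_functions G \<or> J = steinberg_functions G"
  proof (cases "J = singular_functions G")
    case False
    then obtain f where "f \<in> J" "f \<notin> singular_functions G" using J by blast
    then obtain V where "V \<in> bisections" "V \<subseteq> units G" "V \<noteq> {}" "indicator V \<in> J"
      using ideal_contains_unit_indicator[OF assms(3)] J by metis
    then show ?thesis using minimal_ideal_eq[OF assms(2)] J by blast
  qed simp
qed

end

theorem mainTheorem2:
  fixes G :: "'g tgroupoid"
  assumes "ample_groupoid G"
    and "arrows G \<noteq> {}"
  shows "simple_algebra (essential_algebra G :: ('k::field, ('g \<Rightarrow> 'k) set) nu_algebra) \<longleftrightarrow>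
    minimal_groupoid G \<and> topologically_free G"
proof -
  interpret ample_groupoid G by (rule assms(1))
  show ?thesis
    using simple_imp_minimal simple_imp_topologically_free
      simple_if_minimal_topologically_free[OF assms(2)] by blast
qed

end
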